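(* Under the standing assumption below, let $T_\beta=\inf\{n\ge1:\ \mathbb P_{\underline{-1}}(\tau_{\underline{+1}}\le n)\ge 1-e^{-1}\}$. Then for every $t>0$ (equivalently $t\ge0$) $$\lim_{\beta\to\infty}\mathbb P_{\underline{-1}}(\tau_{\underline{+1}}>tT_\beta)=e^{-t},\qquad \lim_{\beta\to\infty}\frac{\mathbb E_{\underline{-1}}[\tau_{\underline{+1}}]}{T_\beta}=1.$$
   Context: Let $\mathbb{T}^2$ denote the triangular lattice embedded in $\mathbb{R}^2$ and $\mathbb{H}^2$ its dual, the hexagonal lattice; each vertex $i$ of $\mathbb{H}^2$ is the centre of a unique closed triangular face of $\mathbb{T}^2$ (the face centred at $i$), and $d$ denotes the graph distance on $\mathbb{H}^2$, so $d(i,j)=1$ iff the faces centred at $i$ and $j$ share an edge. Fix an integer $L\ge1$ and let $\Lambda\subset\mathbb{H}^2$ be the set of sites in a parallelogram of side length $L$ cut along two coordinate axes of $\mathbb{T}^2$, with periodic boundary conditions; thus $\Lambda$ is a discrete torus with $|\Lambda|=2L^2$ sites, each having 3 nearest neighbours. Let $\mathcal X=\{-1,+1\}^\Lambda$ and let $\underline{+1}$, $\underline{-1}$ be the configurations with all spins $+1$, resp. $-1$. For $J,h>0$ the Hamiltonian is $H(\sigma)=-\frac J2\sum_{\{i,j\}\subset\Lambda:\,d(i,j)=1}\sigma(i)\sigma(j)-\frac h2\sum_{i\in\Lambda}\sigma(i)$ (sum over unordered nearest-neighbour pairs), so that $H(\sigma)-H(\underline{-1})=J|\gamma(\sigma)|-hN^+(\sigma)$,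 where $|\gamma(\sigma)|$ is the number of nearest-neighbour pairs carrying opposite spins and $N^+(\sigma)$ is the number of sites with spin $+1$. For $x\in\Lambda$, $\sigma^{(x)}$ denotes $\sigma$ with the spin at $x$ reversed. For $\beta>0$, $(X_t)_{t\in\mathbb N}$ is the Metropolis chain on $\mathcal X$ with $P(\sigma,\sigma^{(x)})=|\Lambda|^{-1}e^{-\beta[H(\sigma^{(x)})-H(\sigma)]_+}$ for $x\in\Lambda$, $P(\sigma,\eta)=0$ if $\eta\neq\sigma$ is not of the form $\sigma^{(x)}$, and $P(\sigma,\sigma)=1-\sum_{\eta\ne\sigma}P(\sigma,\eta)$; it is reversible w.r.t. the Gibbs measure $\mu(\sigma)=e^{-\beta H(\sigma)}/Z$, $Z=\sum_{\eta}e^{-\beta H(\eta)}$. Standing assumption: $0<h<1$, $J\ge2h$, $\frac J{2h}-\frac12\notin\mathbb Z$, and $|\Lambda|\ge(4J/h)^2$. For $A\subset\mathcal X$, $\tau_A=\inf\{t>0:X_t\in A\}$ and $\tau_{\eta}=\tau_{\{\eta\}}$; $\mathbb P_\sigma,\mathbb E_\sigma$ denote probability and expectation for the chain started at $\sigma$. *)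

theory Defs
  imports "HOL-Analysis.Analysis"
begin

text \<open>Sites of the hexagonal torus \<Lambda>: the faces of the triangular lattice in an L x L
parallelogram (periodic).  The unit rhombus with lower corner (a,b) (coordinates mod L,
w.r.t. the two lattice axes) is split into the up-triangle with vertices
(a,b),(a+1,b),(a,b+1) (site (a,b,True)) and the down-triangle with vertices
(a+1,b),(a,b+1),(a+1,b+1) (site (a,b,False)).\<close>

type_synonym site = "nat \<times> nat \<times> bool"

definition sites :: "nat \<Rightarrow> site set" where
  "sites L = {(a, b, s). a < L \<and> b < L}"

text \<open>Two faces are nearest neighbours (d = 1) iff they share an edge:
up(a,b) shares an edge with down(a,b), down(a-1,b), down(a,b-1) (indices mod L).\<close>
definition up_down_adj :: "nat \<Rightarrow> nat \<times> nat \<Rightarrow> nat \<times> nat \<Rightarrow> bool" where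
  "up_down_adj L u d \<longleftrightarrow>
     d = u \<or> d = ((fst u + L - 1) mod L, snd u) \<or> d = (fst u, (snd u + L - 1) mod L)"

definition adj :: "nat \<Rightarrow> site \<Rightarrow> site \<Rightarrow> bool" where
  "adj L x y \<longleftrightarrow> x \<in> sites L \<and> y \<in> sites L \<and>
     (case (x, y) of
        ((a, b, True), (c, e, False)) \<Rightarrow> up_down_adj L (a, b) (c, e)
      | ((a, b, False), (c, e, True)) \<Rightarrow> up_down_adj L (c, e) (a, b)
      | _ \<Rightarrow> False)"

definition nn_pairs :: "nat \<Rightarrow> site set set" where
  "nn_pairs L = {{x, y} | x y. adj L x y}"

definition configs :: "nat \<Rightarrow> (site \<Rightarrow> int) set" where
  "configs L = {\<sigma>. (\<forall>x \<in> sites L. \<sigma> x \<in> {-1, 1}) \<and> (\<forall>x. x \<notin> sites L \<longrightarrow> \<sigma> x = 0)}"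

definition all_plus :: "nat \<Rightarrow> site \<Rightarrow> int" where
  "all_plus L = (\<lambda>x. if x \<in> sites L then 1 else 0)"

definition all_minus :: "nat \<Rightarrow> site \<Rightarrow> int" where
  "all_minus L = (\<lambda>x. if x \<in> sites L then -1 else 0)"

definition flip :: "(site \<Rightarrow> int) \<Rightarrow> site \<Rightarrow> site \<Rightarrow> int" where
  "flip \<sigma> x = \<sigma>(x := - \<sigma> x)"

definition hamiltonian :: "nat \<Rightarrow> real \<Rightarrow> real \<Rightarrow> (site \<Rightarrow> int) \<Rightarrow> real" where
  "hamiltonian L J h \<sigma> =
     - (J / 2) * (\<Sum>e \<in> nn_pairs L. real_of_int (\<Prod>i \<in> e. \<sigma> i))
     - (h / 2) * (\<Sum>i \<in> sites L. real_of_int (\<sigma> i))"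

definition metro_off :: "nat \<Rightarrow> real \<Rightarrow> real \<Rightarrow> real \<Rightarrow> (site \<Rightarrow> int) \<Rightarrow> (site \<Rightarrow> int) \<Rightarrow> real" where
  "metro_off L J h \<beta> \<sigma> \<eta> =
     (if \<eta> \<noteq> \<sigma> \<and> (\<exists>x \<in> sites L. \<eta> = flip \<sigma> x)
      then exp (- \<beta> * max 0 (hamiltonian L J h \<eta> - hamiltonian L J h \<sigma>)) / real (card (sites L))
      else 0)"

definition metro :: "nat \<Rightarrow> real \<Rightarrow> real \<Rightarrow> real \<Rightarrow> (site \<Rightarrow> int) \<Rightarrow> (site \<Rightarrow> int) \<Rightarrow> real" where
  "metro L J h \<beta> \<sigma> \<eta> =
     (if \<eta> = \<sigma> then 1 - (\<Sum>\<zeta> \<in> configs L - {\<sigma>}. metro_off L J h \<beta> \<sigma> \<zeta>)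
      else metro_off L J h \<beta> \<sigma> \<eta>)"

text \<open>hit_prob L J h \<beta> A n \<sigma> = P_\<sigma>(\<tau>_A \<le> n), where \<tau>_A = inf{t > 0. X_t \<in> A},
computed by first-step analysis (X_0 = \<sigma> does not count).\<close>
fun hit_prob :: "nat \<Rightarrow> real \<Rightarrow> real \<Rightarrow> real \<Rightarrow> (site \<Rightarrow> int) set \<Rightarrow> nat \<Rightarrow> (site \<Rightarrow> int) \<Rightarrow> real" where
  "hit_prob L J h \<beta> A 0 \<sigma> = 0"
| "hit_prob L J h \<beta> A (Suc n) \<sigma> =
     (\<Sum>\<eta> \<in> configs L. metro L J h \<beta> \<sigma> \<eta> * (if \<eta> \<in> A then 1 else hit_prob L J h \<beta> A n \<eta>))"

definition expected_hit :: "nat \<Rightarrow> real \<Rightarrow> real \<Rightarrow> real \<Rightarrow> (site \<Rightarrow> int) set \<Rightarrow> (site \<Rightarrow> int) \<Rightarrow> real" where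
  "expected_hit L J h \<beta> A \<sigma> = (\<Sum>n. 1 - hit_prob L J h \<beta> A n \<sigma>)"

definition T_beta :: "nat \<Rightarrow> real \<Rightarrow> real \<Rightarrow> real \<Rightarrow> nat" where
  "T_beta L J h \<beta> =
     (LEAST n. n \<ge> 1 \<and> hit_prob L J h \<beta> {all_plus L} n (all_minus L) \<ge> 1 - exp (-1))"

end

theory Submission
  imports Defs "HOL-Real_Asymp.Real_Asymp"
begin

text \<open>Identify a configuration with its set \<open>A\<close> of plus spins and let
  \<open>F A = H A - H {} = J |cut A| - h |A|\<close>, a submodular function. Let \<open>\<Gamma>\<close> be the least height
  of a path from \<open>{}\<close> to a nonempty set of energy at most 0. Submodularity makes the optimal path
  increasing, and growing a suitable copy of a smallest optimal nucleus on top of any set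
  \<open>\<eta> \<notin> {{}, \<Lambda>}\<close> lowers the energy of \<open>\<eta>\<close> after climbing strictly less than \<open>\<Gamma>\<close>; the copy is
  chosen by arc-transitivity of the hexagonal torus so that it crosses the boundary of \<open>\<eta>\<close>.
  Hence for some \<open>\<delta> > 0\<close> every configuration relaxes to \<open>{}\<close> or \<open>\<Lambda>\<close> in time about
  \<open>exp (\<beta> (\<Gamma> - \<delta>))\<close> by a Poincare inequality along paths, while reversibility shows that leaving
  the valley of \<open>{}\<close> takes time at least of order \<open>exp (\<beta> \<Gamma>)\<close>. The value of \<open>\<Gamma>\<close> and the shape of
  the critical droplet are never needed. With this separation of time scales the exit time is
  asymptotically memoryless, which gives the exponential law; the mean follows by summing the
  approximate renewal inequalities.\<close>

section \<open>Asymptotically memoryless survival functions\<close>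

text \<open>The obstacle is strictness. If a third configuration could hold the chain for a time of
  order \<open>exp (\<beta> * \<Gamma>)\<close>, waiting there would compete with the exit and the
  limit law need not be exponential. As \<open>L\<close> is fixed while \<beta> grows, there are
  finitely many energies: every strict inequality below \<Gamma> improves by one common \<delta>,
  and all factors independent of \<beta> may be estimated crudely. Since the past is never forgotten
  exactly, the product rule for survival probabilities holds only with a pause of length
  \<open>R\<close>, chosen between the scales of relaxation and exit: long enough to reach a
  reference state, too short to leave the valley with noticeable probability. The quantile
  \<open>T\<close> fixes the limit of the survival function at \<open>T\<close> without any estimate
  of \<open>T\<close> itself; the product rule carries this to rational and then to all multiples.
  Convergence in law does not bring convergence of means. This is why the error in both product
  rules carries the factor \<open>u b n\<close>: the rules can then be summed over all
  times.\<close>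

text \<open>In the application \<open>u b n\<close> is the probability that a chain at inverse temperature \<open>b\<close>,
  started in the metastable state, has not reached the stable one by time \<open>n\<close>; within \<open>R b\<close> steps
  the chain reaches one of the two states up to probability \<open>\<epsilon> b\<close>, and \<open>q b\<close> bounds the exit rate.\<close>

locale almost_memoryless =
  fixes u :: "real \<Rightarrow> nat \<Rightarrow> real" and R :: "real \<Rightarrow> nat" and \<epsilon> q :: "real \<Rightarrow> real"
  assumes u_nonneg: "\<And>b n. b > 0 \<Longrightarrow> 0 \<le> u b n"
    and u_0: "\<And>b. b > 0 \<Longrightarrow> u b 0 = 1"
    and u_Suc: "\<And>b n. b > 0 \<Longrightarrow> u b (Suc n) \<le> u b n"
    and upper: "\<And>b n m. b > 0 \<Longrightarrow> u b (n + R b + m) \<le> u b n * (u b m + \<epsilon> b)"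
    and lower: "\<And>b n m. b > 0 \<Longrightarrow> u b (n + m) \<ge> (u b (n + R b) - \<epsilon> b * u b n) * u b m"
    and slow: "\<And>b n. b > 0 \<Longrightarrow> 1 - u b n \<le> real n * q b"
    and R_pos: "\<And>b. b > 0 \<Longrightarrow> R b \<ge> 1"
    and eps_nonneg: "\<And>b. b > 0 \<Longrightarrow> \<epsilon> b \<ge> 0"
    and eps_tendsto: "(\<epsilon> \<longlongrightarrow> 0) at_top"
    and Rq_tendsto: "((\<lambda>b. real (R b) * q b) \<longlongrightarrow> 0) at_top"
    and summable_u: "\<And>b. b > 0 \<Longrightarrow> summable (u b)"
begin

section \<open>Approximate multiplicativity of the survival function\<close>

definition T :: "real \<Rightarrow> nat" where
  "T b = (LEAST n. n \<ge> 1 \<and> u b n \<le> exp (-1))"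

definition \<delta> :: "real \<Rightarrow> real" where
  "\<delta> b = \<epsilon> b + 2 * real (R b) * q b"

lemma delta_tendsto: "(\<delta> \<longlongrightarrow> 0) at_top"
  unfolding \<delta>_def
  using tendsto_add[OF eps_tendsto tendsto_mult[OF tendsto_const[of 2] Rq_tendsto]]
  by (simp add: mult.assoc)

lemma u_antimono: "b > 0 \<Longrightarrow> n \<le> m \<Longrightarrow> u b m \<le> u b n"
  using lift_Suc_antimono_le[of "u b" n m] u_Suc by blast

lemma u_le_1: "b > 0 \<Longrightarrow> u b n \<le> 1"
  using u_antimono[of b 0 n] u_0 by simp

lemma delta_nonneg: assumes "b > 0" shows "\<delta> b \<ge> 0"
proof -
  have "0 \<le> real (2 * R b) * q b" using slow[OF assms, of "2 * R b"] u_le_1[OF assms, of "2 * R b"] by linarith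
  then show ?thesis using eps_nonneg[OF assms] unfolding \<delta>_def by simp
qed

text \<open>\<open>slow\<close> bounds the loss only from time 0. The lower product rule carries it
  to \<open>n = k + R b\<close> by comparing the times \<open>k\<close> and
  \<open>k + 2 * R b\<close>, which is why \<open>\<delta>\<close> contains the loss over
  \<open>2 * R b\<close> steps. For \<open>n < R b\<close> the window lies within the first
  \<open>2 * R b\<close> steps.\<close>

lemma R_drop: assumes b: "b > 0" shows "u b n - u b (n + R b) \<le> \<delta> b"
proof (cases "n \<ge> R b")
  case True
  then obtain k where n: "n = k + R b" by (metis le_Suc_ex add.commute)
  have s: "1 - u b (2 * R b) \<le> 2 * real (R b) * q b" using slow[OF b, of "2 * R b"] by simp
  have "\<epsilon> b * u b k \<le> \<epsilon> b" using u_le_1[OF b] eps_nonneg[OF b] by (simp add: mult_left_le)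
  then have "(u b n - \<epsilon> b) * u b (2 * R b) \<le> (u b (k + R b) - \<epsilon> b * u b k) * u b (2 * R b)"
    using u_nonneg[OF b, of "2 * R b"] unfolding n by (intro mult_right_mono) auto
  also have "\<dots> \<le> u b (k + 2 * R b)" using lower[OF b] by simp
  also have "k + 2 * R b = n + R b" using n by simp
  finally have 1: "(u b n - \<epsilon> b) * u b (2 * R b) \<le> u b (n + R b)" .
  have "u b n * (1 - u b (2 * R b)) \<le> 1 * (1 - u b (2 * R b))"
    using u_le_1[OF b] by (intro mult_right_mono) auto
  moreover have "\<epsilon> b * u b (2 * R b) \<le> \<epsilon> b" using u_le_1[OF b] eps_nonneg[OF b] by (simp add: mult_left_le)
  ultimately show ?thesis using 1 s unfolding \<delta>_def by (simp add: algebra_simps)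
next
  case False
  have "1 - u b (2 * R b) \<le> 2 * real (R b) * q b" using slow[OF b, of "2 * R b"] by simp
  moreover have "u b (2 * R b) \<le> u b (n + R b)" using False by (intro u_antimono[OF b]) auto
  ultimately show ?thesis using u_le_1[OF b, of n] eps_nonneg[OF b] unfolding \<delta>_def by linarith
qed

text \<open>Each single step is charged a whole window \<open>R b\<close>. This wasteful count still
  vanishes in the limit, because \<open>k\<close> is later kept fixed while \<open>b\<close>
  grows.\<close>

lemma steps_drop: assumes b: "b > 0" shows "u b n - u b (n + k) \<le> real k * \<delta> b"
proof (induction k)
  case (Suc k)
  have "u b (n + k + R b) \<le> u b (n + Suc k)" using R_pos[OF b] by (intro u_antimono[OF b]) auto
  then show ?case using Suc R_drop[OF b, of "n + k"] by (simp add: algebra_simps)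
qed simp

text \<open>Both product rules contain a pause \<open>R b\<close>; by \<open>R_drop\<close>,
  deleting it costs \<open>\<delta> b\<close>.\<close>

lemma almost_multiplicative:
  assumes b: "b > 0" shows "\<bar>u b (n + m) - u b n * u b m\<bar> \<le> \<epsilon> b + \<delta> b"
proof -
  have "u b (n + m) \<le> u b (n + R b + m) + \<delta> b" using R_drop[OF b, of "n + m"] by (simp add: add_ac)
  also have "\<dots> \<le> u b n * (u b m + \<epsilon> b) + \<delta> b" using upper[OF b] by simp
  also have "\<dots> \<le> u b n * u b m + \<epsilon> b + \<delta> b"
    using mult_right_mono[OF u_le_1[OF b, of n] eps_nonneg[OF b]] by (simp add: algebra_simps)
  finally have 1: "u b (n + m) \<le> u b n * u b m + \<epsilon> b + \<delta> b" .
  have "\<epsilon> b * u b n \<le> \<epsilon> b" using u_le_1[OF b] eps_nonneg[OF b] by (simp add: mult_left_le)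
  then have "(u b n - \<delta> b - \<epsilon> b) * u b m \<le> (u b (n + R b) - \<epsilon> b * u b n) * u b m"
    using R_drop[OF b, of n] u_nonneg[OF b] by (intro mult_right_mono) auto
  also have "\<dots> \<le> u b (n + m)" using lower[OF b] .
  finally have "u b n * u b m - (\<delta> b + \<epsilon> b) * u b m \<le> u b (n + m)" by (simp add: algebra_simps)
  moreover have "(\<delta> b + \<epsilon> b) * u b m \<le> \<delta> b + \<epsilon> b"
    using u_le_1[OF b] eps_nonneg[OF b] delta_nonneg[OF b] by (simp add: mult_left_le)
  ultimately show ?thesis using 1 by linarith
qed

lemma almost_power:
  assumes b: "b > 0" shows "\<bar>u b (j * m) - u b m ^ j\<bar> \<le> real j * (\<epsilon> b + \<delta> b)"
proof (induction j)
  case 0 then show ?case using u_0[OF b] by simp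
next
  case (Suc j)
  have "\<bar>u b m * (u b (j * m) - u b m ^ j)\<bar> \<le> 1 * \<bar>u b (j * m) - u b m ^ j\<bar>"
    unfolding abs_mult using u_le_1[OF b] u_nonneg[OF b] by (intro mult_right_mono) auto
  then show ?case using Suc almost_multiplicative[OF b, of m "j * m"] by (simp add: algebra_simps)
qed

section \<open>The quantile time and the exponential law\<close>

lemma eventually_pos: "eventually (\<lambda>b::real. b > 0) at_top" by (rule eventually_gt_at_top)

lemma T_props:
  assumes b: "b > 0"
  shows "T b \<ge> 1" "u b (T b) \<le> exp (-1)" "u b (T b - 1) > exp (-1)"
proof -
  have "u b \<longlonglongrightarrow> 0" using summable_LIMSEQ_zero[OF summable_u[OF b]] .
  then have "eventually (\<lambda>n. u b n < exp (-1)) sequentially" by (rule order_tendstoD) simp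
  then obtain n where "\<forall>k\<ge>n. u b k < exp (-1)" unfolding eventually_sequentially by blast
  then have "Suc n \<ge> 1 \<and> u b (Suc n) \<le> exp (-1)" by (simp add: less_imp_le)
  from LeastI[of "\<lambda>n. n \<ge> 1 \<and> u b n \<le> exp (-1)", OF this]
  show 1: "T b \<ge> 1" "u b (T b) \<le> exp (-1)" unfolding T_def by auto
  show "u b (T b - 1) > exp (-1)"
  proof (cases "T b = 1")
    \<comment> \<open>The predecessor 0 is excluded from the \<open>LEAST\<close> by
      \<open>n \<ge> 1\<close>, so this case rests on \<open>u b 0 = 1\<close>.\<close>
    case True then show ?thesis using u_0[OF b] by simp
  next
    case False
    then have "T b - 1 < T b" "T b - 1 \<ge> 1" using 1 by auto
    with not_less_Least[of "T b - 1" "\<lambda>n. n \<ge> 1 \<and> u b n \<le> exp (-1)"] show ?thesis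
      unfolding T_def by auto
  qed
qed

lemma tendsto_zeroI:
  fixes f g :: "real \<Rightarrow> real"
  assumes "\<And>b. b > 0 \<Longrightarrow> \<bar>f b\<bar> \<le> g b" "(g \<longlongrightarrow> 0) at_top"
  shows "(f \<longlongrightarrow> 0) at_top"
proof (rule Lim_null_comparison[OF _ assms(2)])
  show "\<forall>\<^sub>F x in at_top. norm (f x) \<le> g x" using eventually_pos by eventually_elim (use assms(1) in auto)
qed

text \<open>\<open>u\<close> crosses the level \<open>exp (-1)\<close> in the single step before
  \<open>T\<close>, and one step loses at most \<open>\<delta>\<close>.\<close>

lemma u_T_tendsto: "((\<lambda>b. u b (T b)) \<longlongrightarrow> exp (-1)) at_top"
proof (rule LIM_zero_cancel, rule tendsto_zeroI[OF _ delta_tendsto])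
  fix b :: real assume b: "b > 0"
  show "\<bar>u b (T b) - exp (- 1)\<bar> \<le> \<delta> b"
    using T_props[OF b] steps_drop[OF b, of "T b - 1" 1] by simp
qed

lemma error_tendsto: "((\<lambda>b. real j * (\<epsilon> b + \<delta> b)) \<longlongrightarrow> 0) at_top"
  using tendsto_mult[OF tendsto_const[of "real j"] tendsto_add[OF eps_tendsto delta_tendsto]]
  by simp

lemma u_power_tendsto:
  assumes "((\<lambda>b. u b (m b)) \<longlongrightarrow> l) at_top"
  shows "((\<lambda>b. u b (j * m b)) \<longlongrightarrow> l ^ j) at_top"
proof -
  have "((\<lambda>b. u b (j * m b) - u b (m b) ^ j) \<longlongrightarrow> 0) at_top"
    by (rule tendsto_zeroI[OF almost_power]) (assumption, rule error_tendsto)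
  from tendsto_add[OF this tendsto_power[OF assms, of j]] show ?thesis by simp
qed

lemma u_shift_tendsto:
  assumes "((\<lambda>b. u b (m b)) \<longlongrightarrow> l) at_top"
    and "\<And>b. b > 0 \<Longrightarrow> m b \<le> m' b + k \<and> m' b \<le> m b + k"
  shows "((\<lambda>b. u b (m' b)) \<longlongrightarrow> l) at_top"
proof -
  have "((\<lambda>b. real k * \<delta> b) \<longlongrightarrow> 0) at_top"
    using tendsto_mult[OF tendsto_const[of "real k"] delta_tendsto] by simp
  then have "((\<lambda>b. u b (m' b) - u b (m b)) \<longlongrightarrow> 0) at_top"
  proof (rule tendsto_zeroI[rotated])
    fix b :: real assume b: "b > 0"
    show "\<bar>u b (m' b) - u b (m b)\<bar> \<le> real k * \<delta> b"
      using steps_drop[OF b, of "m b" k] steps_drop[OF b, of "m' b" k] assms(2)[OF b]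
        u_antimono[OF b, of "m b" "m' b + k"] u_antimono[OF b, of "m' b" "m b + k"] by linarith
  qed
  from tendsto_add[OF this assms(1)] show ?thesis by simp
qed

text \<open>The \<open>k\<close>-th power of \<open>u b (T b div k)\<close> is close to
  \<open>u\<close> at \<open>k * (T b div k)\<close>, fewer than \<open>k\<close> steps away from
  \<open>T b\<close>. Then take \<open>k\<close>-th roots.\<close>

lemma u_T_div_tendsto:
  assumes k: "k > 0"
  shows "((\<lambda>b. u b (T b div k)) \<longlongrightarrow> exp (- 1 / k)) at_top"
proof -
  have "((\<lambda>b. u b (k * (T b div k))) \<longlongrightarrow> exp (-1)) at_top"
  proof (rule u_shift_tendsto[OF u_T_tendsto, of _ k])
    fix b show "T b \<le> k * (T b div k) + k \<and> k * (T b div k) \<le> T b + k"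
      using mult_div_mod_eq[of k "T b"] mod_less_divisor[OF k, of "T b"] by linarith
  qed
  moreover have "((\<lambda>b. u b (k * (T b div k)) - u b (T b div k) ^ k) \<longlongrightarrow> 0) at_top"
    by (rule tendsto_zeroI[OF almost_power]) (assumption, rule error_tendsto)
  ultimately have "((\<lambda>b. u b (k * (T b div k)) - (u b (k * (T b div k)) - u b (T b div k) ^ k)) \<longlongrightarrow> exp (-1) - 0) at_top"
    by (rule tendsto_diff)
  then have "((\<lambda>b. root k (u b (T b div k) ^ k)) \<longlongrightarrow> root k (exp (-1))) at_top"
    by (intro tendsto_real_root) simp
  moreover have "root k (exp (-1)) = exp (- 1 / k)"
  proof (rule real_root_pos_unique[OF k])
    show "exp (- 1 / real k) ^ k = exp (- 1)" using k by (simp flip: exp_of_nat_mult)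
  qed simp
  moreover have "\<forall>\<^sub>F b in at_top. root k (u b (T b div k) ^ k) = u b (T b div k)"
    using eventually_pos by eventually_elim (use k u_nonneg in \<open>simp add: real_root_power_cancel\<close>)
  ultimately show ?thesis using tendsto_cong[of "\<lambda>b. root k (u b (T b div k) ^ k)"] by simp
qed

lemma exp_power_div: "exp (- 1 / real k) ^ j = exp (- real j / real k)"
  by (simp flip: exp_of_nat_mult)

theorem exponential_limit:
  assumes t: "t > 0"
  shows "((\<lambda>b. u b (nat \<lfloor>t * real (T b)\<rfloor>)) \<longlongrightarrow> exp (- t)) at_top"
proof (rule order_tendstoI)
  have lim: "((\<lambda>k. exp (- t + c / real k)) \<longlonglongrightarrow> exp (- t + 0))" for c :: real
    by (intro tendsto_intros lim_const_over_n)
  {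
    fix a :: real assume "a < exp (- t)"
    then have "a < exp (- t + 0)" by simp
    from eventually_happens'[OF sequentially_bot eventually_conj[OF eventually_gt_at_top[of 0]
        order_tendstoD(1)[OF lim[of "-1"] this]]]
    obtain k where k: "k > 0" "exp (- t + - 1 / real k) > a" by blast
    \<comment> \<open>The number of blocks and their length are both rounded up, so together they
      cover \<open>t * T\<close> and monotonicity gives a lower bound.\<close>
    define j where "j = Suc (nat \<lfloor>t * real k\<rfloor>)"
    have j: "real j \<le> t * real k + 1" "t * real k < real j" using t k(1)
      unfolding j_def by (auto simp: of_nat_nat) linarith+
    have "((\<lambda>b. u b (Suc (T b div k))) \<longlongrightarrow> exp (- 1 / k)) at_top"
      by (rule u_shift_tendsto[OF u_T_div_tendsto[OF k(1)], of _ 1]) auto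
    from u_power_tendsto[OF this, of j]
    have "((\<lambda>b. u b (j * Suc (T b div k))) \<longlongrightarrow> exp (- real j / real k)) at_top"
      unfolding exp_power_div .
    moreover have "a < exp (- real j / real k)"
    proof -
      have "real j / real k \<le> t + 1 / real k"
        using divide_right_mono[OF j(1), of "real k"] k(1) by (simp add: add_divide_distrib)
      then have "exp (- t + - 1 / real k) \<le> exp (- real j / real k)" by simp
      with k(2) show ?thesis by (rule less_le_trans)
    qed
    ultimately have "\<forall>\<^sub>F b in at_top. a < u b (j * Suc (T b div k))" by (rule order_tendstoD)
    then show "\<forall>\<^sub>F b in at_top. a < u b (nat \<lfloor>t * real (T b)\<rfloor>)"
      using eventually_pos
    proof eventually_elim
      case (elim b)
      have "real (T b) < real k * real (Suc (T b div k))"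
        using dividend_less_times_div[OF k(1), of "T b"] unfolding of_nat_mult[symmetric] of_nat_less_iff by simp
      then have "t * real (T b) \<le> t * (real k * real (Suc (T b div k)))"
        using t by (intro mult_left_mono) auto
      also have "\<dots> \<le> real j * real (Suc (T b div k))"
        unfolding mult.assoc[symmetric] using j by (intro mult_right_mono) auto
      finally have "t * real (T b) \<le> real (j * Suc (T b div k))" unfolding of_nat_mult .
      then have "nat \<lfloor>t * real (T b)\<rfloor> \<le> j * Suc (T b div k)"
        unfolding nat_le_iff floor_le_iff by (simp only: of_int_of_nat_eq)
      then show ?case using u_antimono[OF elim(2)] elim(1) by (meson less_le_trans)
    qed
  }
  {
    fix a :: real assume "exp (- t) < a"
    then have "exp (- t + 0) < a" by simp
    from eventually_happens'[OF sequentially_bot eventually_conj[OF eventually_gt_at_top[of 0]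
        order_tendstoD(2)[OF lim[of 1] this]]]
    obtain k where k: "k > 0" "exp (- t + 1 / real k) < a" by blast
    \<comment> \<open>Now both are rounded down, so the blocks fit into \<open>t * T\<close> and
      monotonicity gives an upper bound.\<close>
    define j where "j = nat \<lfloor>t * real k\<rfloor>"
    have j: "real j \<le> t * real k" "t * real k - 1 \<le> real j" using t k(1)
      unfolding j_def by auto
    from u_power_tendsto[OF u_T_div_tendsto[OF k(1)], of j]
    have "((\<lambda>b. u b (j * (T b div k))) \<longlongrightarrow> exp (- real j / real k)) at_top"
      unfolding exp_power_div .
    moreover have "exp (- real j / real k) < a"
    proof -
      have "t - 1 / real k \<le> real j / real k"
        using divide_right_mono[OF j(2), of "real k"] k(1) by (simp add: diff_divide_distrib)
      then have "exp (- real j / real k) \<le> exp (- t + 1 / real k)" by simp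
      then show ?thesis using k(2) by (rule le_less_trans)
    qed
    ultimately have "\<forall>\<^sub>F b in at_top. u b (j * (T b div k)) < a" by (rule order_tendstoD)
    then show "\<forall>\<^sub>F b in at_top. u b (nat \<lfloor>t * real (T b)\<rfloor>) < a"
      using eventually_pos
    proof eventually_elim
      case (elim b)
      have "k * (T b div k) \<le> T b" by simp
      then have "real k * real (T b div k) \<le> real (T b)" by (metis of_nat_le_iff of_nat_mult)
      then have "t * (real k * real (T b div k)) \<le> t * real (T b)"
        using t by (intro mult_left_mono) auto
      moreover have "real j * real (T b div k) \<le> t * (real k * real (T b div k))"
        unfolding mult.assoc[symmetric] using j by (intro mult_right_mono) auto
      ultimately have "real (j * (T b div k)) \<le> t * real (T b)" unfolding of_nat_mult by (rule order_trans[rotated])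
      then have "j * (T b div k) \<le> nat \<lfloor>t * real (T b)\<rfloor>" by (simp add: le_nat_floor)
      then show ?case using u_antimono[OF elim(2)] elim(1) by (meson le_less_trans)
    qed
  }
qed

section \<open>Convergence of the mean\<close>

lemma R_over_T_tendsto: "((\<lambda>b. real (R b) / real (T b)) \<longlongrightarrow> 0) at_top"
proof (rule tendsto_zeroI)
  define c :: real where "c = 1 - exp (-1)"
  have c: "c > 0" unfolding c_def by simp
  fix b :: real assume b: "b > 0"
  \<comment> \<open>By time \<open>T\<close> a fixed probability \<open>c\<close> is lost, so
    \<open>slow\<close> forces \<open>T\<close> to be at least of order
    \<open>1 / q\<close>.\<close>
  have "c \<le> real (T b) * q b" using slow[OF b, of "T b"] T_props(2)[OF b] unfolding c_def by linarith
  then have "real (R b) * c \<le> real (R b) * (real (T b) * q b)" by (rule mult_left_mono) simp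
  then show "\<bar>real (R b) / real (T b)\<bar> \<le> (real (R b) * q b) / (1 - exp (-1))"
    using c T_props(1)[OF b] unfolding c_def[symmetric] by (simp add: field_simps)
next
  show "((\<lambda>b. (real (R b) * q b) / (1 - exp (-1))) \<longlongrightarrow> 0) at_top"
    using tendsto_divide[OF Rq_tendsto tendsto_const[of "1 - exp (-1::real)"]] by simp
qed

lemma inverse_T_tendsto: "((\<lambda>b. 1 / real (T b)) \<longlongrightarrow> 0) at_top"
proof (rule tendsto_zeroI[OF _ R_over_T_tendsto])
  fix b :: real assume b: "b > 0"
  show "\<bar>1 / real (T b)\<bar> \<le> real (R b) / real (T b)"
    using R_pos[OF b] by (simp add: divide_right_mono)
qed

lemma floor_T_over_T_tendsto:
  assumes "s > 0" shows "((\<lambda>b. real (nat \<lfloor>s * real (T b)\<rfloor>) / real (T b)) \<longlongrightarrow> s) at_top"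
proof (rule LIM_zero_cancel, rule tendsto_zeroI[OF _ inverse_T_tendsto])
  fix b :: real assume b: "b > 0"
  have T: "real (T b) > 0" using T_props(1)[OF b] by simp
  have "\<bar>real (nat \<lfloor>s * real (T b)\<rfloor>) - s * real (T b)\<bar> \<le> 1" using assms T by (simp add: of_nat_nat) linarith
  then have "\<bar>real (nat \<lfloor>s * real (T b)\<rfloor>) - s * real (T b)\<bar> / real (T b) \<le> 1 / real (T b)"
    using T by (intro divide_right_mono) auto
  moreover have "real (nat \<lfloor>s * real (T b)\<rfloor>) / real (T b) - s = (real (nat \<lfloor>s * real (T b)\<rfloor>) - s * real (T b)) / real (T b)"
    using T by (simp add: field_simps)
  ultimately show "\<bar>real (nat \<lfloor>s * real (T b)\<rfloor>) / real (T b) - s\<bar> \<le> 1 / real (T b)" using T by simp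
qed

text \<open>Sum the upper product rule over \<open>n\<close>; the \<open>m + R b\<close> initial
  terms left out are at most 1 each. The inequality stays undivided because the bracket becomes
  positive only for suitable \<open>m\<close> and large \<open>b\<close>.\<close>

lemma suminf_upper:
  assumes b: "b > 0"
  shows "suminf (u b) * (1 - u b m - \<epsilon> b) \<le> real m + real (R b)"
proof -
  note sm = summable_u[OF b]
  have "(\<Sum>n. u b (n + (m + R b))) \<le> (\<Sum>n. u b n * (u b m + \<epsilon> b))"
  proof (rule suminf_le)
    show "u b (n + (m + R b)) \<le> u b n * (u b m + \<epsilon> b)" for n
      using upper[OF b, of n m] by (simp add: add_ac)
  qed (use sm summable_ignore_initial_segment summable_mult2 in blast)+
  also have "\<dots> = suminf (u b) * (u b m + \<epsilon> b)" using suminf_mult2[OF sm] by simp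
  finally have "suminf (u b) \<le> suminf (u b) * (u b m + \<epsilon> b) + (\<Sum>n<m + R b. u b n)"
    using suminf_split_initial_segment[OF sm, of "m + R b"] by simp
  moreover have "(\<Sum>n<m + R b. u b n) \<le> (\<Sum>n<m + R b. 1)" by (intro sum_mono u_le_1[OF b])
  ultimately show ?thesis by (simp add: algebra_simps)
qed

text \<open>Sum the lower product rule over \<open>n\<close>; the first \<open>m\<close> terms are
  at least \<open>u b m\<close> each, the first \<open>R b\<close> at most 1 each.\<close>

lemma suminf_lower:
  assumes b: "b > 0"
  shows "suminf (u b) * (1 - u b m * (1 - \<epsilon> b)) \<ge> u b m * (real m - real (R b))"
proof -
  note sm = summable_u[OF b]
  have smR: "summable (\<lambda>n. u b (n + R b))" using sm summable_ignore_initial_segment by blast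
  have "(\<Sum>n. (u b (n + R b) - \<epsilon> b * u b n) * u b m) \<le> (\<Sum>n. u b (n + m))"
  proof (rule suminf_le)
    show "summable (\<lambda>n. u b (n + m))" using sm summable_ignore_initial_segment by blast
    show "summable (\<lambda>n. (u b (n + R b) - \<epsilon> b * u b n) * u b m)"
      by (intro summable_mult2 summable_diff summable_mult sm smR)
  qed (use lower[OF b] in simp)
  also have "(\<Sum>n. (u b (n + R b) - \<epsilon> b * u b n) * u b m) = ((\<Sum>n. u b (n + R b)) - \<epsilon> b * suminf (u b)) * u b m"
    by (subst suminf_mult2[symmetric]) (auto intro!: summable_diff summable_mult sm smR simp: suminf_diff[symmetric] suminf_mult sm summable_mult smR)
  also have "(\<Sum>n. u b (n + R b)) = suminf (u b) - (\<Sum>n<R b. u b n)"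
    using suminf_split_initial_segment[OF sm, of "R b"] by simp
  finally have 1: "(suminf (u b) - (\<Sum>n<R b. u b n) - \<epsilon> b * suminf (u b)) * u b m
      \<le> suminf (u b) - (\<Sum>n<m. u b n)"
    using suminf_split_initial_segment[OF sm, of m] by simp
  have "(\<Sum>n<R b. u b n) \<le> (\<Sum>n<R b. 1)" by (intro sum_mono u_le_1[OF b])
  then have "(suminf (u b) - real (R b) - \<epsilon> b * suminf (u b)) * u b m
     \<le> (suminf (u b) - (\<Sum>n<R b. u b n) - \<epsilon> b * suminf (u b)) * u b m"
    using u_nonneg[OF b] by (intro mult_right_mono) auto
  moreover have "(\<Sum>n<m. u b m) \<le> (\<Sum>n<m. u b n)" by (intro sum_mono u_antimono[OF b]) auto
  ultimately show ?thesis using 1 by (simp add: algebra_simps)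
qed

text \<open>With \<open>m\<close> close to \<open>s * T\<close>, the two summed inequalities squeeze
  the ratio asymptotically between \<open>exp (- s) * s / (1 - exp (- s))\<close> and
  \<open>s / (1 - exp (- s))\<close>. First \<open>s\<close> is chosen small, and only then does
  \<open>b\<close> tend to infinity.\<close>

theorem mean_limit: "((\<lambda>b. suminf (u b) / real (T b)) \<longlongrightarrow> 1) at_top"
proof -
  define m where "m s b = nat \<lfloor>s * real (T b)\<rfloor>" for s b
  have um: "((\<lambda>b. u b (m s b)) \<longlongrightarrow> exp (- s)) at_top" if "s > 0" for s
    unfolding m_def using exponential_limit[OF that] .
  have mT: "((\<lambda>b. real (m s b) / real (T b)) \<longlongrightarrow> s) at_top" if "s > 0" for s
    unfolding m_def using floor_T_over_T_tendsto[OF that] .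
  have sub: "suminf (u b) / real (T b) * (1 - u b (m s b) - \<epsilon> b) \<le> real (m s b) / real (T b) + real (R b) / real (T b)"
    if "b > 0" for s b
    using divide_right_mono[OF suminf_upper[OF that, of "m s b"], of "real (T b)"]
    by (simp add: add_divide_distrib)
  have slb: "suminf (u b) / real (T b) * (1 - u b (m s b) * (1 - \<epsilon> b)) \<ge> u b (m s b) * (real (m s b) / real (T b) - real (R b) / real (T b))"
    if "b > 0" for s b
    using divide_right_mono[OF suminf_lower[OF that, of "m s b"], of "real (T b)"]
    by (simp add: diff_divide_distrib right_diff_distrib)
  have quot: "((\<lambda>s::real. s / (1 - exp (- s))) \<longlongrightarrow> 1) (at_right 0)"
             "((\<lambda>s::real. exp (- s) * s / (1 - exp (- s))) \<longlongrightarrow> 1) (at_right 0)"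
    by real_asymp+
  show ?thesis
  proof (rule order_tendstoI)
    fix a :: real assume "1 < a"
    then have "\<forall>\<^sub>F s in at_right 0. s / (1 - exp (- s)) < a" by (rule order_tendstoD[OF quot(1)])
    then obtain s :: real where s: "s > 0" "s / (1 - exp (- s)) < a"
      using eventually_happens'[OF trivial_limit_at_right_real eventually_conj[OF eventually_at_right_less]]
      by blast
    have den: "1 - exp (- s) > 0" using s by simp
    have "((\<lambda>b. 1 - u b (m s b) - \<epsilon> b) \<longlongrightarrow> 1 - exp (- s) - 0) at_top"
      by (intro tendsto_intros um s eps_tendsto)
    then have d: "((\<lambda>b. 1 - u b (m s b) - \<epsilon> b) \<longlongrightarrow> 1 - exp (- s)) at_top" by simp
    have "((\<lambda>b. (real (m s b) / real (T b) + real (R b) / real (T b)) / (1 - u b (m s b) - \<epsilon> b))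
        \<longlongrightarrow> (s + 0) / (1 - exp (- s))) at_top"
      using den by (intro tendsto_intros mT s R_over_T_tendsto d) auto
    then have "\<forall>\<^sub>F b in at_top. (real (m s b) / real (T b) + real (R b) / real (T b)) / (1 - u b (m s b) - \<epsilon> b) < a"
      by (rule order_tendstoD) (use s in simp)
    moreover have "\<forall>\<^sub>F b in at_top. 0 < 1 - u b (m s b) - \<epsilon> b" using order_tendstoD(1)[OF d den] .
    ultimately show "\<forall>\<^sub>F b in at_top. suminf (u b) / real (T b) < a"
      using eventually_pos
    proof eventually_elim
      case (elim b)
      then show ?case using sub[OF elim(3), of s] by (meson le_less_trans pos_le_divide_eq)
    qed
  next
    fix a :: real assume "a < 1"
    then have "\<forall>\<^sub>F s in at_right 0. exp (- s) * s / (1 - exp (- s)) > a" by (rule order_tendstoD[OF quot(2)])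
    then obtain s :: real where s: "s > 0" "exp (- s) * s / (1 - exp (- s)) > a"
      using eventually_happens'[OF trivial_limit_at_right_real eventually_conj[OF eventually_at_right_less]]
      by blast
    have den: "1 - exp (- s) > 0" using s by simp
    have "((\<lambda>b. 1 - u b (m s b) * (1 - \<epsilon> b)) \<longlongrightarrow> 1 - exp (- s) * (1 - 0)) at_top"
      by (intro tendsto_intros um s eps_tendsto)
    then have d: "((\<lambda>b. 1 - u b (m s b) * (1 - \<epsilon> b)) \<longlongrightarrow> 1 - exp (- s)) at_top" by simp
    have "((\<lambda>b. u b (m s b) * (real (m s b) / real (T b) - real (R b) / real (T b)) / (1 - u b (m s b) * (1 - \<epsilon> b)))
        \<longlongrightarrow> exp (- s) * (s - 0) / (1 - exp (- s))) at_top"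
      using den by (intro tendsto_divide tendsto_mult tendsto_diff um mT s R_over_T_tendsto d) auto
    then have "\<forall>\<^sub>F b in at_top. u b (m s b) * (real (m s b) / real (T b) - real (R b) / real (T b)) / (1 - u b (m s b) * (1 - \<epsilon> b)) > a"
      by (rule order_tendstoD) (use s in simp)
    moreover have "\<forall>\<^sub>F b in at_top. 0 < 1 - u b (m s b) * (1 - \<epsilon> b)" using order_tendstoD(1)[OF d den] .
    ultimately show "\<forall>\<^sub>F b in at_top. a < suminf (u b) / real (T b)"
      using eventually_pos
    proof eventually_elim
      case (elim b)
      then show ?case using slb[OF elim(3), of s] by (meson less_le_trans pos_divide_le_eq)
    qed
  qed
qed

end

section \<open>Survival probabilities of finite reversible chains\<close>

locale reversible_chain =
  fixes S :: "'a set" and P :: "'a \<Rightarrow> 'a \<Rightarrow> real" and w :: "'a \<Rightarrow> real"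
  assumes fin: "finite S"
    and P_nonneg: "\<And>x y. x \<in> S \<Longrightarrow> y \<in> S \<Longrightarrow> 0 \<le> P x y"
    and P_row: "\<And>x. x \<in> S \<Longrightarrow> (\<Sum>y\<in>S. P x y) = 1"
    and w_pos: "\<And>x. x \<in> S \<Longrightarrow> 0 < w x"
    and reversible: "\<And>x y. x \<in> S \<Longrightarrow> y \<in> S \<Longrightarrow> w x * P x y = w y * P y x"
begin

text \<open>The starting point is not tested, in accordance with hitting times that are positive by
  definition; the value at \<open>n = 0\<close> is 1 even on \<open>A\<close>.\<close>

primrec surv :: "'a set \<Rightarrow> nat \<Rightarrow> 'a \<Rightarrow> real" where
  "surv A 0 x = 1"
| "surv A (Suc n) x = (\<Sum>y\<in>S - A. P x y * surv A n y)"

lemma surv_nonneg: "x \<in> S \<Longrightarrow> 0 \<le> surv A n x"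
  by (induction n arbitrary: x) (auto intro!: sum_nonneg mult_nonneg_nonneg P_nonneg)

lemma P_row_le_1: assumes "x \<in> S" "B \<subseteq> S" shows "(\<Sum>y\<in>B. P x y) \<le> 1"
  using sum_mono2[OF fin assms(2), of "P x"] P_row[OF assms(1)] P_nonneg[OF assms(1)] by auto

lemma surv_Suc_le: "x \<in> S \<Longrightarrow> surv A (Suc n) x \<le> surv A n x"
proof (induction n arbitrary: x)
  case 0 then show ?case using P_row_le_1[of x "S - A"] by auto
next
  case (Suc n)
  have "surv A (Suc (Suc n)) x = (\<Sum>y\<in>S - A. P x y * surv A (Suc n) y)" by simp
  also have "\<dots> \<le> (\<Sum>y\<in>S - A. P x y * surv A n y)"
    using Suc by (intro sum_mono mult_left_mono P_nonneg) auto
  finally show ?case by simp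
qed

lemma surv_antimono: "x \<in> S \<Longrightarrow> n \<le> m \<Longrightarrow> surv A m x \<le> surv A n x"
  using lift_Suc_antimono_le[of "\<lambda>n. surv A n x" n m] surv_Suc_le by blast

lemma surv_le_1: "x \<in> S \<Longrightarrow> surv A n x \<le> 1"
  using surv_antimono[of x 0 n] by simp

lemma surv_target_mono: "x \<in> S \<Longrightarrow> A \<subseteq> B \<Longrightarrow> surv B n x \<le> surv A n x"
proof (induction n arbitrary: x)
  case (Suc n)
  have "(\<Sum>y\<in>S - B. P x y * surv B n y) \<le> (\<Sum>y\<in>S - B. P x y * surv A n y)"
    using Suc by (intro sum_mono mult_left_mono P_nonneg) auto
  also have "\<dots> \<le> (\<Sum>y\<in>S - A. P x y * surv A n y)"
    using Suc.prems fin by (intro sum_mono2) (auto intro: mult_nonneg_nonneg P_nonneg surv_nonneg)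
  finally show ?case by simp
qed simp

section \<open>Dirichlet form and decay of survival probabilities\<close>

definition energy :: "('a \<Rightarrow> real) \<Rightarrow> real" where
  "energy f = (\<Sum>x\<in>S. \<Sum>y\<in>S. w x * P x y * (f x - f y)\<^sup>2)"

text \<open>Green's identity. As \<open>energy\<close> sums over ordered pairs, it is twice the
  Dirichlet form, which is the source of the factor 2 in the Poincare inequalities. After expanding
  the square, one diagonal term comes from the row sums, the other from reversibility.\<close>

lemma energy_eq:
  "energy f = 2 * (\<Sum>x\<in>S. w x * f x * (f x - (\<Sum>y\<in>S. P x y * f y)))"
proof -
  have a: "(\<Sum>x\<in>S. \<Sum>y\<in>S. w x * P x y * (f x)\<^sup>2) = (\<Sum>x\<in>S. w x * (f x)\<^sup>2)"
  proof (intro sum.cong refl)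
    fix x assume "x \<in> S"
    have "(\<Sum>y\<in>S. w x * P x y * (f x)\<^sup>2) = w x * (f x)\<^sup>2 * (\<Sum>y\<in>S. P x y)"
      unfolding sum_distrib_left by (intro sum.cong refl) simp
    then show "(\<Sum>y\<in>S. w x * P x y * (f x)\<^sup>2) = w x * (f x)\<^sup>2" using P_row[OF \<open>x \<in> S\<close>] by simp
  qed
  have "(\<Sum>x\<in>S. \<Sum>y\<in>S. w x * P x y * (f y)\<^sup>2) = (\<Sum>y\<in>S. \<Sum>x\<in>S. w x * P x y * (f y)\<^sup>2)"
    by (rule sum.swap)
  also have "\<dots> = (\<Sum>y\<in>S. \<Sum>x\<in>S. w y * P y x * (f y)\<^sup>2)"
    by (intro sum.cong refl) (simp add: reversible)
  finally have b: "(\<Sum>x\<in>S. \<Sum>y\<in>S. w x * P x y * (f y)\<^sup>2) = (\<Sum>x\<in>S. w x * (f x)\<^sup>2)"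
    using a by simp
  have c: "(\<Sum>x\<in>S. \<Sum>y\<in>S. w x * P x y * (f x * f y)) = (\<Sum>x\<in>S. w x * f x * (\<Sum>y\<in>S. P x y * f y))"
    unfolding sum_distrib_left by (intro sum.cong refl) simp
  have "energy f = (\<Sum>x\<in>S. \<Sum>y\<in>S. w x * P x y * (f x)\<^sup>2) + (\<Sum>x\<in>S. \<Sum>y\<in>S. w x * P x y * (f y)\<^sup>2)
      - 2 * (\<Sum>x\<in>S. \<Sum>y\<in>S. w x * P x y * (f x * f y))"
    unfolding energy_def sum.distrib[symmetric] sum_distrib_left sum_subtractf[symmetric]
    by (intro sum.cong refl) (simp add: power2_eq_square algebra_simps)
  also have "\<dots> = 2 * (\<Sum>x\<in>S. w x * (f x)\<^sup>2) - 2 * (\<Sum>x\<in>S. w x * f x * (\<Sum>y\<in>S. P x y * f y))"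
    unfolding a b by (simp add: c)
  also have "\<dots> = 2 * (\<Sum>x\<in>S. w x * f x * (f x - (\<Sum>y\<in>S. P x y * f y)))"
    by (simp add: sum_subtractf power2_eq_square algebra_simps)
  finally show ?thesis .
qed

lemma energy_edge:
  assumes "x \<in> S" "y \<in> S" shows "w x * P x y * (f x - f y)\<^sup>2 \<le> energy f"
proof -
  have n: "0 \<le> w a * P a b * (f a - f b)\<^sup>2" if "a \<in> S" "b \<in> S" for a b
    using P_nonneg[OF that] w_pos[OF that(1)] by simp
  have "w x * P x y * (f x - f y)\<^sup>2 \<le> (\<Sum>y\<in>S. w x * P x y * (f x - f y)\<^sup>2)"
    using assms fin n by (intro member_le_sum) auto
  also have "\<dots> \<le> energy f"
    unfolding energy_def using assms fin n by (intro member_le_sum sum_nonneg) auto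
  finally show ?thesis .
qed

text \<open>Because survival probabilities decrease in time, the Dirichlet form of \<open>surv A n\<close> controls
  its decay in the weighted L2 norm without any bound on the bottom of the spectrum.\<close>

lemma surv_decay:
  assumes A: "A \<subseteq> S"
    and poincare: "\<And>f. (\<And>x. x \<in> A \<Longrightarrow> f x = 0) \<Longrightarrow> 2 * \<kappa> * (\<Sum>x\<in>S. w x * (f x)\<^sup>2) \<le> energy f"
    and x: "x \<in> S - A"
  shows "w x * (surv A n x)\<^sup>2 \<le> exp (- \<kappa> * real n) * (\<Sum>x\<in>S. w x)"
proof -
  \<comment> \<open>Cutting \<open>surv\<close> off on \<open>A\<close> gives the zero boundary
    values that \<open>poincare\<close> asks for, and applying \<open>P\<close> still advances the
    time by one.\<close>
  define f where "f n x = (if x \<in> A then 0 else surv A n x)" for n x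
  define N where "N n = (\<Sum>x\<in>S. w x * (f n x)\<^sup>2)" for n
  have f0: "0 \<le> f n x" if "x \<in> S" for n x using surv_nonneg[OF that] unfolding f_def by simp
  have fm: "f (Suc n) x \<le> f n x" if "x \<in> S" for n x
    using surv_Suc_le[OF that] unfolding f_def by simp
  have Pf: "(\<Sum>y\<in>S. P x y * f n y) = surv A (Suc n) x" for n x
  proof -
    have "(\<Sum>y\<in>S. P x y * f n y) = (\<Sum>y\<in>S - A. P x y * f n y)"
      using fin by (intro sum.mono_neutral_right) (auto simp: f_def)
    then show ?thesis by (simp add: f_def)
  qed
  have step: "N (Suc n) \<le> exp (- \<kappa>) * N n" for n
  proof -
    have "2 * \<kappa> * N n \<le> energy (f n)" unfolding N_def by (rule poincare) (simp add: f_def)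
    also have "\<dots> = 2 * (\<Sum>x\<in>S. w x * f n x * (f n x - f (Suc n) x))"
      unfolding energy_eq Pf by (intro arg_cong[where f = "(*) 2"] sum.cong refl) (simp add: f_def)
    finally have "\<kappa> * N n \<le> (\<Sum>x\<in>S. w x * f n x * (f n x - f (Suc n) x))" by simp
    also have "\<dots> = N n - (\<Sum>x\<in>S. w x * f n x * f (Suc n) x)"
      unfolding N_def by (simp add: sum_subtractf power2_eq_square algebra_simps)
    also have "(\<Sum>x\<in>S. w x * f n x * f (Suc n) x) \<ge> N (Suc n)"
      unfolding N_def power2_eq_square mult.assoc
      using f0 fm w_pos by (intro sum_mono mult_left_mono mult_right_mono) (auto simp: less_imp_le)
    ultimately have "N (Suc n) \<le> (1 + - \<kappa>) * N n" by (simp add: algebra_simps)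
    also have "\<dots> \<le> exp (- \<kappa>) * N n"
      using exp_ge_add_one_self[of "- \<kappa>"] w_pos unfolding N_def
      by (intro mult_right_mono sum_nonneg mult_nonneg_nonneg) (auto simp: less_imp_le)
    finally show ?thesis .
  qed
  have "N n \<le> exp (- \<kappa> * real n) * N 0"
  proof (induction n)
    case (Suc n)
    have "N (Suc n) \<le> exp (- \<kappa>) * N n" by (rule step)
    also have "\<dots> \<le> exp (- \<kappa>) * (exp (- \<kappa> * real n) * N 0)" using Suc by (intro mult_left_mono) auto
    also have "\<dots> = exp (- \<kappa> * real (Suc n)) * N 0"
      unfolding mult.assoc[symmetric] exp_add[symmetric] by (simp add: algebra_simps)
    finally show ?case .
  qed simp
  also have "N 0 \<le> (\<Sum>x\<in>S. w x)"
    unfolding N_def f_def using w_pos by (intro sum_mono) (auto simp: less_imp_le)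
  finally have "N n \<le> exp (- \<kappa> * real n) * (\<Sum>x\<in>S. w x)" by simp
  moreover have "w x * (f n x)\<^sup>2 \<le> N n"
    unfolding N_def using x fin w_pos
    by (intro member_le_sum) (auto intro!: mult_nonneg_nonneg simp: less_imp_le)
  ultimately show ?thesis using x unfolding f_def by simp
qed

text \<open>Along a path from \<open>x\<close> to the zero set \<open>A\<close>, each increment of
  \<open>f\<close> is at most \<open>sqrt (energy f / (c * w x))\<close>, each edge being charged
  the whole energy. Telescoping over at most \<open>l\<close> edges bounds
  \<open>w x * (f x)\<^sup>2\<close>, and summing over \<open>x\<close> costs the factor
  \<open>card S\<close>. Conductances are measured relative to the weight of the start, since the
  climb of a path will be bounded relative to the energy of its start.\<close>

lemma poincare_paths:
  assumes c: "c > 0" and l: "l \<ge> 1"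
    and paths: "\<And>x. x \<in> S - A \<Longrightarrow> \<exists>n\<le>l. \<exists>y\<in>A.
      ((\<lambda>a b. a \<in> S \<and> b \<in> S \<and> w a * P a b \<ge> c * w x) ^^ n) x y"
    and f: "\<And>x. x \<in> A \<Longrightarrow> f x = 0"
  shows "2 * (c / (2 * real (card S) * real l ^ 2)) * (\<Sum>x\<in>S. w x * (f x)\<^sup>2) \<le> energy f"
proof -
  have E0: "energy f \<ge> 0" unfolding energy_def
    using P_nonneg w_pos by (intro sum_nonneg mult_nonneg_nonneg) (auto simp: less_imp_le)
  have *: "w x * (f x)\<^sup>2 \<le> real l ^ 2 * energy f / c" if x: "x \<in> S" for x
  proof (cases "x \<in> A")
    case True then show ?thesis using f E0 c by simp
  next
    case False
    define r where "r = sqrt (energy f / (c * w x))"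
    have wx: "w x > 0" using w_pos x by simp
    have walk: "\<bar>f a - f b\<bar> \<le> real n * r"
      if "((\<lambda>a b. a \<in> S \<and> b \<in> S \<and> w a * P a b \<ge> c * w x) ^^ n) a b" for n a b
      using that
    proof (induction n arbitrary: b)
      case (Suc n)
      then obtain d where d: "((\<lambda>a b. a \<in> S \<and> b \<in> S \<and> w a * P a b \<ge> c * w x) ^^ n) a d"
        and db: "d \<in> S" "b \<in> S" "w d * P d b \<ge> c * w x" by auto
      have "c * w x * (f d - f b)\<^sup>2 \<le> w d * P d b * (f d - f b)\<^sup>2"
        using db by (intro mult_right_mono) auto
      also have "\<dots> \<le> energy f" using energy_edge db by blast
      finally have "(f d - f b)\<^sup>2 \<le> energy f / (c * w x)" using c wx by (simp add: field_simps)
      then have "\<bar>f d - f b\<bar> \<le> r" unfolding r_def by (metis real_sqrt_abs real_sqrt_le_mono)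
      then show ?case using Suc.IH[OF d] by (simp add: algebra_simps)
    qed simp
    obtain n y where n: "n \<le> l" "y \<in> A"
      "((\<lambda>a b. a \<in> S \<and> b \<in> S \<and> w a * P a b \<ge> c * w x) ^^ n) x y"
      using paths[of x] False x by auto
    have r0: "r \<ge> 0" unfolding r_def using E0 c wx by simp
    have "\<bar>f x\<bar> \<le> real n * r" using walk[OF n(3)] f[OF n(2)] by simp
    also have "\<dots> \<le> real l * r" using n(1) r0 by (intro mult_right_mono) auto
    finally have "\<bar>f x\<bar>\<^sup>2 \<le> (real l * r)\<^sup>2" by (intro power_mono) auto
    then have "(f x)\<^sup>2 \<le> real l ^ 2 * (energy f / (c * w x))"
      unfolding r_def power_mult_distrib using E0 c wx by simp
    then show ?thesis using c wx by (simp add: field_simps)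
  qed
  have "(\<Sum>x\<in>S. w x * (f x)\<^sup>2) \<le> (\<Sum>x\<in>S. real l ^ 2 * energy f / c)" by (intro sum_mono *)
  also have "\<dots> = real (card S) * real l ^ 2 * energy f / c" by simp
  finally have **: "(\<Sum>x\<in>S. w x * (f x)\<^sup>2) \<le> real (card S) * real l ^ 2 * energy f / c" .
  show ?thesis
  proof (cases "card S = 0")
    case True
    then show ?thesis using E0 by simp
  next
    case False
    then have K: "real (card S) * real l ^ 2 > 0" using l by simp
  have "2 * (c / (2 * real (card S) * real l ^ 2)) * (\<Sum>x\<in>S. w x * (f x)\<^sup>2)
      = c / (real (card S) * real l ^ 2) * (\<Sum>x\<in>S. w x * (f x)\<^sup>2)" by simp
  also have "\<dots> \<le> c / (real (card S) * real l ^ 2) * (real (card S) * real l ^ 2 * energy f / c)"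
    using c K ** by (intro mult_left_mono) auto
  also have "\<dots> = energy f" using c False l by simp
  finally show ?thesis .
  qed
qed

text \<open>Start from the measure \<open>w\<close> restricted to \<open>V\<close>. By
  reversibility, one step inside \<open>V\<close> does not increase this measure, so every step
  leaks at most the flux through the boundary of \<open>V\<close>. At the end keep only the term of
  \<open>m\<close>.\<close>

lemma surv_valley:
  assumes V: "V \<subseteq> S" and m: "m \<in> V"
  shows "w m * (1 - surv (S - V) n m) \<le> real n * (\<Sum>x\<in>V. \<Sum>y\<in>S - V. w x * P x y)"
proof -
  define g where "g n x = 1 - surv (S - V) n x" for n x
  define Q where "Q = (\<Sum>x\<in>V. \<Sum>y\<in>S - V. w x * P x y)"
  have SV: "S - (S - V) = V" using V by auto
  have finV: "finite V" using V fin finite_subset by auto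
  have gSuc: "g (Suc n) x = (\<Sum>y\<in>S - V. P x y) + (\<Sum>y\<in>V. P x y * g n y)" if "x \<in> S" for n x
  proof -
    have "(\<Sum>y\<in>S. P x y) = (\<Sum>y\<in>S - V. P x y) + (\<Sum>y\<in>V. P x y)"
      using sum.subset_diff[OF V fin] .
    then show ?thesis using P_row[OF that] unfolding g_def
      by (simp add: SV right_diff_distrib sum_subtractf)
  qed
  have g0: "0 \<le> g n x" if "x \<in> S" for n x using surv_le_1[OF that] unfolding g_def by simp
  have tot: "(\<Sum>x\<in>V. w x * g n x) \<le> real n * Q"
  proof (induction n)
    case 0 then show ?case by (simp add: g_def)
  next
    case (Suc n)
    have "(\<Sum>x\<in>V. w x * g (Suc n) x) = (\<Sum>x\<in>V. w x * ((\<Sum>y\<in>S - V. P x y) + (\<Sum>y\<in>V. P x y * g n y)))"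
      using V by (intro sum.cong refl) (simp add: gSuc subset_iff)
    also have "\<dots> = Q + (\<Sum>x\<in>V. \<Sum>y\<in>V. w x * P x y * g n y)"
      unfolding Q_def by (simp add: distrib_left sum_distrib_left sum.distrib mult.assoc)
    also have "(\<Sum>x\<in>V. \<Sum>y\<in>V. w x * P x y * g n y) = (\<Sum>y\<in>V. \<Sum>x\<in>V. w x * P x y * g n y)"
      by (rule sum.swap)
    also have "\<dots> = (\<Sum>y\<in>V. w y * g n y * (\<Sum>x\<in>V. P y x))"
      unfolding sum_distrib_left using V
      by (intro sum.cong refl) (simp add: reversible[of _ y for y] subset_iff mult_ac)
    also have "\<dots> \<le> (\<Sum>y\<in>V. w y * g n y * 1)"
      using V g0 w_pos P_row_le_1 by (intro sum_mono mult_left_mono mult_nonneg_nonneg) (auto simp: less_imp_le subset_iff)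
    finally show ?case using Suc by (simp add: algebra_simps)
  qed
  have "w m * g n m \<le> (\<Sum>x\<in>V. w x * g n x)"
    using m V finV g0 w_pos by (intro member_le_sum) (auto intro!: mult_nonneg_nonneg simp: less_imp_le subset_iff)
  with tot show ?thesis unfolding g_def Q_def by linarith
qed

section \<open>Renewal inequalities at a reference state\<close>

lemma surv_add_le:
  assumes "x \<in> S" and "\<And>y. y \<in> S - A \<Longrightarrow> surv A k y \<le> C" and "x \<notin> A"
  shows "surv A (n + k) x \<le> surv A n x * C"
  using assms(1,3)
proof (induction n arbitrary: x)
  \<comment> \<open>Before any step is made the bound \<open>C\<close> must apply to
    \<open>x\<close> itself; this is where \<open>x \<notin> A\<close> enters.\<close>
  case 0 then show ?case using assms(2) by simp
next
  case (Suc n)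
  have "surv A (Suc n + k) x = (\<Sum>y\<in>S - A. P x y * surv A (n + k) y)" by simp
  also have "\<dots> \<le> (\<Sum>y\<in>S - A. P x y * (surv A n y * C))"
    using Suc by (intro sum_mono mult_left_mono P_nonneg) auto
  also have "\<dots> = surv A (Suc n) x * C" by (simp add: sum_distrib_right mult.assoc)
  finally show ?case .
qed

text \<open>A surviving chain either avoids \<open>m\<close> during the first \<open>r\<close> steps
  or visits it, and after that visit at least \<open>k\<close> steps remain to be survived.\<close>

lemma surv_upper:
  assumes p: "p \<in> S" and m: "m \<in> S" "m \<noteq> p" and x: "x \<in> S"
  shows "surv {p} (r + k) x \<le> surv {p, m} r x + surv {p} k m"
  using x
proof (induction r arbitrary: x)
  case 0 then show ?case using surv_le_1[OF 0, of "{p}" k] surv_nonneg[OF m(1), of "{p}" k] by simp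
next
  case (Suc r)
  have sp: "S - {p} = insert m (S - {p, m})" using m by auto
  have "surv {p} (Suc r + k) x = (\<Sum>y\<in>S - {p}. P x y * surv {p} (r + k) y)" by simp
  also have "\<dots> = P x m * surv {p} (r + k) m + (\<Sum>y\<in>S - {p, m}. P x y * surv {p} (r + k) y)"
    unfolding sp using fin by (subst sum.insert) auto
  also have "\<dots> \<le> P x m * surv {p} k m
      + (\<Sum>y\<in>S - {p, m}. P x y * (surv {p, m} r y + surv {p} k m))"
    using Suc m surv_antimono[OF m(1), of k "r + k" "{p}"]
    by (intro add_mono sum_mono mult_left_mono P_nonneg) auto
  also have "\<dots> = surv {p, m} (Suc r) x + (P x m + (\<Sum>y\<in>S - {p, m}. P x y)) * surv {p} k m"
    by (simp add: distrib_left distrib_right sum.distrib sum_distrib_right)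
  also have "P x m + (\<Sum>y\<in>S - {p, m}. P x y) = (\<Sum>y\<in>S - {p}. P x y)"
    unfolding sp using fin by (subst sum.insert) auto
  also have "(\<Sum>y\<in>S - {p}. P x y) * surv {p} k m \<le> surv {p} k m"
    using P_row_le_1[OF Suc.prems, of "S - {p}"] surv_nonneg[OF m(1)]
    by (intro mult_left_le_one_le sum_nonneg P_nonneg Suc.prems) auto
  finally show ?case by simp
qed

text \<open>The difference is the probability of avoiding \<open>p\<close> for \<open>r\<close>
  steps while visiting \<open>m\<close>. Surviving \<open>k\<close> steps counted from the first
  such visit means surviving more than \<open>k\<close> steps in all.\<close>

lemma surv_lower:
  assumes p: "p \<in> S" and m: "m \<in> S" "m \<noteq> p" and x: "x \<in> S"
  shows "(surv {p} r x - surv {p, m} r x) * surv {p} k m \<le> surv {p} k x"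
  using x
proof (induction r arbitrary: x k)
  case 0 then show ?case using surv_nonneg[OF 0] by simp
next
  case (Suc r)
  have sp: "S - {p} = insert m (S - {p, m})" using m by auto
  have le: "surv {p, m} i y \<le> surv {p} i y" if "y \<in> S" for i y
    using that by (intro surv_target_mono) auto
  show ?case
  proof (cases k)
    case 0
    have "surv {p} (Suc r) x - surv {p, m} (Suc r) x \<le> 1"
      using surv_le_1[OF Suc.prems, of "{p}" "Suc r"] surv_nonneg[OF Suc.prems, of "{p, m}" "Suc r"] by linarith
    then show ?thesis using 0 by simp
  next
    case (Suc j)
    have "surv {p} (Suc r) x - surv {p, m} (Suc r) x
        = P x m * surv {p} r m + (\<Sum>y\<in>S - {p, m}. P x y * (surv {p} r y - surv {p, m} r y))"
      unfolding surv.simps sp using fin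
      by (subst sum.insert) (auto simp: right_diff_distrib sum_subtractf)
    then have "(surv {p} (Suc r) x - surv {p, m} (Suc r) x) * surv {p} k m
        = P x m * (surv {p} r m * surv {p} k m) + (\<Sum>y\<in>S - {p, m}. P x y * ((surv {p} r y - surv {p, m} r y) * surv {p} k m))"
      by (simp add: distrib_right sum_distrib_right mult.assoc)
    also have "\<dots> \<le> P x m * surv {p} j m + (\<Sum>y\<in>S - {p, m}. P x y * surv {p} j y)"
    proof (intro add_mono sum_mono mult_left_mono P_nonneg Suc.prems m)
      have km: "surv {p} k m \<le> surv {p} j m" unfolding Suc using m by (intro surv_antimono) auto
      have "surv {p} r m * surv {p} k m \<le> 1 * surv {p} k m"
        using surv_le_1 surv_nonneg m by (intro mult_right_mono) auto
      then show "surv {p} r m * surv {p} k m \<le> surv {p} j m" using km by simp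
      fix y assume y: "y \<in> S - {p, m}"
      have "(surv {p} r y - surv {p, m} r y) * surv {p} k m \<le> (surv {p} r y - surv {p, m} r y) * surv {p} j m"
        using km le[of y r] y by (intro mult_left_mono) auto
      also have "\<dots> \<le> surv {p} j y" using Suc.IH y by simp
      finally show "(surv {p} r y - surv {p, m} r y) * surv {p} k m \<le> surv {p} j y" .
    qed (use \<open>x \<in> S\<close> in auto)
    also have "\<dots> = surv {p} k x"
      unfolding Suc surv.simps sp using fin by (subst sum.insert) auto
    finally show ?thesis .
  qed
qed

text \<open>Stop at time \<open>n\<close> at an unknown position and let \<open>r\<close> steps
  pass: \<open>surv_upper\<close> replaces the position by \<open>m\<close> at the price
  \<open>e\<close>. The position \<open>m\<close> is treated apart because \<open>e\<close> bounds
  nothing there.\<close>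

lemma surv_renewal_upper:
  assumes p: "p \<in> S" and m: "m \<in> S" "m \<noteq> p"
    and e: "e \<ge> 0" "\<And>x. x \<in> S - {p, m} \<Longrightarrow> surv {p, m} r x \<le> e"
  shows "surv {p} (n + r + k) m \<le> surv {p} n m * (surv {p} k m + e)"
proof -
  have "surv {p} (n + (r + k)) m \<le> surv {p} n m * (surv {p} k m + e)"
  proof (rule surv_add_le)
    fix y assume y: "y \<in> S - {p}"
    show "surv {p} (r + k) y \<le> surv {p} k m + e"
    proof (cases "y = m")
      case True
      then show ?thesis using e(1) surv_antimono[OF m(1), of k "r + k" "{p}"] by simp
    next
      case False
      then show ?thesis using surv_upper[OF p m, of y r k] e(2)[of y] y by simp
    qed
  qed (use m in auto)
  then show ?thesis by (simp add: add_ac)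
qed

text \<open>From a position \<open>y\<close> other than \<open>m\<close> at time \<open>n\<close>,
  the chain visits \<open>m\<close> within \<open>r\<close> steps with probability at least
  \<open>surv {p} r y - e\<close> and can be continued from there. Averaging over \<open>y\<close>
  turns \<open>surv {p} r y\<close> into survival up to time \<open>n + r\<close>.\<close>

lemma surv_renewal_lower:
  assumes p: "p \<in> S" and m: "m \<in> S" "m \<noteq> p"
    and e: "e \<ge> 0" "\<And>x. x \<in> S - {p, m} \<Longrightarrow> surv {p, m} r x \<le> e"
  shows "surv {p} (n + k) m \<ge> (surv {p} (n + r) m - e * surv {p} n m) * surv {p} k m"
proof -
  have *: "(surv {p} r y - e) * surv {p} k m \<le> surv {p} k y" if y: "y \<in> S - {p}" for y
  proof (cases "y = m")
    case True
    have "(surv {p} r y - e) * surv {p} k m \<le> 1 * surv {p} k m"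
      using surv_le_1[of y "{p}" r] surv_nonneg m e(1) y by (intro mult_right_mono) auto
    then show ?thesis using True by simp
  next
    case False
    have "(surv {p} r y - e) * surv {p} k m \<le> (surv {p} r y - surv {p, m} r y) * surv {p} k m"
      using e(2)[of y] False y surv_nonneg m by (intro mult_right_mono) auto
    also have "\<dots> \<le> surv {p} k y" using surv_lower[OF p m, of y r k] y by simp
    finally show ?thesis .
  qed
  have "(surv {p} (n + r) x - e * surv {p} n x) * surv {p} k m \<le> surv {p} (n + k) x" if "x \<in> S - {p}" for x
    using that
  proof (induction n arbitrary: x)
    case 0 then show ?case using * by simp
  next
    case (Suc n)
    have "(surv {p} (Suc n + r) x - e * surv {p} (Suc n) x) * surv {p} k m
      = (\<Sum>y\<in>S - {p}. P x y * ((surv {p} (n + r) y - e * surv {p} n y) * surv {p} k m))"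
      by (simp add: sum_distrib_left sum_distrib_right sum_subtractf[symmetric] algebra_simps)
    also have "\<dots> \<le> (\<Sum>y\<in>S - {p}. P x y * surv {p} (n + k) y)"
      using Suc by (intro sum_mono mult_left_mono P_nonneg) auto
    finally show ?case by simp
  qed
  from this[of m] show ?thesis using m by simp
qed

end

section \<open>Submodular energy landscapes\<close>

text \<open>What nucleation uses of the lattice. \<open>F_isolated\<close> provides neighbours
  inside a minimal nucleus, and \<open>arc_transitive\<close> moves such a pair of neighbours onto
  any pair given by \<open>boundary\<close>.\<close>

locale landscape =
  fixes V :: "'v set" and F :: "'v set \<Rightarrow> real" and nb :: "'v \<Rightarrow> 'v \<Rightarrow> bool"
  assumes finV: "finite V" and V_ne: "V \<noteq> {}"
    and F_empty: "F {} = 0"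
    and submodular: "\<And>A B. A \<subseteq> V \<Longrightarrow> B \<subseteq> V \<Longrightarrow> F (A \<union> B) + F (A \<inter> B) \<le> F A + F B"
    and F_single: "\<And>v. v \<in> V \<Longrightarrow> F {v} > 0"
    and F_V: "F V < 0"
    and F_isolated: "\<And>A v. A \<subseteq> V \<Longrightarrow> v \<in> A \<Longrightarrow> (\<And>y. y \<in> A \<Longrightarrow> \<not> nb v y) \<Longrightarrow> F (A - {v}) \<le> F A"
    and arc_transitive: "\<And>x y x' y'. x \<in> V \<Longrightarrow> y \<in> V \<Longrightarrow> x' \<in> V \<Longrightarrow> y' \<in> V \<Longrightarrow> nb x y \<Longrightarrow> nb x' y' \<Longrightarrow>
       \<exists>g. bij_betw g V V \<and> g x = x' \<and> g y = y' \<and> (\<forall>A\<subseteq>V. F (g ` A) = F A)"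
    and boundary: "\<And>A. A \<subseteq> V \<Longrightarrow> A \<noteq> {} \<Longrightarrow> A \<noteq> V \<Longrightarrow> \<exists>x\<in>A. \<exists>y\<in>V - A. nb x y"
begin

section \<open>Paths and increasing chains\<close>

definition step :: "real \<Rightarrow> 'v set \<Rightarrow> 'v set \<Rightarrow> bool" where
  "step \<gamma> A B \<longleftrightarrow> A \<subseteq> V \<and> B \<subseteq> V \<and> F A \<le> \<gamma> \<and> F B \<le> \<gamma> \<and>
     (\<exists>v\<in>V. v \<notin> A \<and> B = insert v A \<or> v \<in> A \<and> B = A - {v})"

text \<open>Repetitions are allowed so that intersecting a chain with a fixed set yields a chain
  again (\<open>chain_Int\<close>).\<close>

definition chain :: "real \<Rightarrow> nat \<Rightarrow> (nat \<Rightarrow> 'v set) \<Rightarrow> bool" where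
  "chain \<gamma> m a \<longleftrightarrow> a 0 = {} \<and> (\<forall>k<m. \<exists>v\<in>V. a (Suc k) = a k \<or> a (Suc k) = insert v (a k)) \<and>
     (\<forall>k\<le>m. F (a k) \<le> \<gamma>)"

text \<open>Energy 0 is included so that a nonempty subset of \<open>V\<close> that fails to be
  supercritical has strictly positive energy; \<open>descent\<close> draws its strict inequality
  from this.\<close>

definition supercritical :: "'v set \<Rightarrow> bool" where
  "supercritical A \<longleftrightarrow> A \<subseteq> V \<and> A \<noteq> {} \<and> F A \<le> 0"

lemma chain_height: "chain \<gamma> m a \<Longrightarrow> k \<le> m \<Longrightarrow> F (a k) \<le> \<gamma>"
  by (simp add: chain_def)

lemma chain_Suc:
  assumes "chain \<gamma> m a" "k < m"
  obtains v where "v \<in> V" "a (Suc k) = a k \<or> a (Suc k) = insert v (a k)"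
  using assms unfolding chain_def by blast

lemma chain_subset: "chain \<gamma> m a \<Longrightarrow> k \<le> m \<Longrightarrow> a k \<subseteq> V"
proof (induction k)
  case (Suc k)
  then have "a k \<subseteq> V" "k < m" by auto
  with chain_Suc[OF Suc.prems(1)] show ?case by (metis insert_subset)
qed (simp add: chain_def)

lemma chain_mono:
  assumes "chain \<gamma> m a" "i \<le> j" "j \<le> m" shows "a i \<subseteq> a j"
  using assms(2,3)
proof (induction j rule: dec_induct)
  case (step n)
  then have "n < m" by simp
  with chain_Suc[OF assms(1)] have "a n \<subseteq> a (Suc n)" by (metis order_refl subset_insertI)
  then show ?case using step by auto
qed simp

lemma chain_prefix: "chain \<gamma> m a \<Longrightarrow> k \<le> m \<Longrightarrow> chain \<gamma> k a"
  by (auto simp: chain_def)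

lemma chain_Int:
  assumes "chain \<gamma> m a" and "\<And>k. k \<le> m \<Longrightarrow> F (a k \<inter> B) \<le> \<gamma>'"
  shows "chain \<gamma>' m (\<lambda>k. a k \<inter> B)"
  unfolding chain_def
proof (intro conjI allI impI)
  show "a 0 \<inter> B = {}" using assms(1) by (simp add: chain_def)
  fix k assume "k < m"
  then obtain v where "v \<in> V" "a (Suc k) = a k \<or> a (Suc k) = insert v (a k)"
    using chain_Suc[OF assms(1)] by blast
  then show "\<exists>v\<in>V. a (Suc k) \<inter> B = a k \<inter> B \<or> a (Suc k) \<inter> B = insert v (a k \<inter> B)" by auto
qed (use assms(2) in auto)

lemma chain_image:
  assumes "chain \<gamma> m a" and g: "bij_betw g V V" "\<forall>A\<subseteq>V. F (g ` A) = F A"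
  shows "chain \<gamma> m (\<lambda>k. g ` a k)"
  unfolding chain_def
proof (intro conjI allI impI)
  show "g ` a 0 = {}" using assms(1) by (simp add: chain_def)
  fix k assume "k < m"
  then obtain v where "v \<in> V" "a (Suc k) = a k \<or> a (Suc k) = insert v (a k)"
    using chain_Suc[OF assms(1)] by blast
  then show "\<exists>v\<in>V. g ` a (Suc k) = g ` a k \<or> g ` a (Suc k) = insert v (g ` a k)"
    using g(1) by (intro bexI[of _ "g v"]) (auto simp: bij_betw_def)
next
  fix k assume k: "k \<le> m"
  show "F (g ` a k) \<le> \<gamma>" using chain_subset[OF assms(1) k] g(2) chain_height[OF assms(1) k] by simp
qed

lemma chain_snoc:
  assumes "chain \<gamma> m a" "v \<in> V" "F (insert v (a m)) \<le> \<gamma>"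
  shows "chain \<gamma> (Suc m) (a(Suc m := insert v (a m)))"
  using assms unfolding chain_def by (auto simp: less_Suc_eq le_Suc_eq)

text \<open>The seed of a chain: sets grow from \<open>{}\<close> by at most one site at a time, so
  the first nonempty one is a singleton. The seed later anchors a copy of the nucleus inside a given
  set.\<close>

lemma chain_first:
  assumes "chain \<gamma> m a" "a m \<noteq> {}"
  shows "\<exists>v\<in>V. v \<in> a m \<and> (\<forall>k\<le>m. a k \<noteq> {} \<longrightarrow> v \<in> a k) \<and> (\<exists>k\<le>m. a k = {v})"
proof -
  define k where "k = (LEAST k. a k \<noteq> {})"
  have k: "a k \<noteq> {}" "k \<le> m" unfolding k_def
    using assms(2) LeastI[of "\<lambda>k. a k \<noteq> {}"] Least_le[of "\<lambda>k. a k \<noteq> {}"] by auto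
  have before: "a j = {}" if "j < k" for j using not_less_Least[of j "\<lambda>k. a k \<noteq> {}"] that unfolding k_def by auto
  obtain j where j: "k = Suc j" using k(1) assms(1) unfolding chain_def by (cases k) auto
  then obtain v where v: "v \<in> V" "a k = a j \<or> a k = insert v (a j)"
    using chain_Suc[OF assms(1), of j] k(2) by auto
  then have ak: "a k = {v}" using k(1) before[of j] j by auto
  have "v \<in> a i" if "i \<le> m" "a i \<noteq> {}" for i
    using before[of i] that chain_mono[OF assms(1), of k i] ak by (cases "i < k") auto
  then show ?thesis using v(1) ak k assms(2) by blast
qed

text \<open>Monotonisation: by submodularity, a path that also removes sites can be replaced by an
  increasing one of at most the same height that ends in a larger set of at most the same energy.
  When the path leaves the current increasing chain \<open>a\<close> through a subset \<open>Y\<close> of its end, the chain is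
  cut down to the minimiser of \<open>F\<close> among the \<open>a k \<union> Y\<close>.\<close>

lemma monotone_path:
  assumes "(step \<gamma>)\<^sup>*\<^sup>* {} X" and "\<gamma> \<ge> 0"
  shows "\<exists>m a. chain \<gamma> m a \<and> X \<subseteq> a m \<and> F (a m) \<le> F X"
  using assms(1)
proof (induction rule: rtranclp_induct)
  case base
  have "chain \<gamma> 0 (\<lambda>_. {})" using assms(2) by (simp add: chain_def F_empty)
  then show ?case by (intro exI[of _ 0] exI[of _ "\<lambda>_. {}"]) simp
next
  case (step X Y)
  then obtain m a where a: "chain \<gamma> m a" "X \<subseteq> a m" "F (a m) \<le> F X" by blast
  have sub: "a k \<subseteq> V" if "k \<le> m" for k using chain_subset[OF a(1) that] .
  have Y: "Y \<subseteq> V" "F Y \<le> \<gamma>" and X: "X \<subseteq> V" using step(2) unfolding step_def by auto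
  show ?case
  proof (cases "Y \<subseteq> a m")
    case True
    obtain k0 where k0: "k0 \<le> m" "\<And>k. k \<le> m \<Longrightarrow> F (a k0 \<union> Y) \<le> F (a k \<union> Y)"
      using ex_is_arg_min_if_finite[of "{..m}" "\<lambda>k. F (a k \<union> Y)"]
      unfolding is_arg_min_linorder by auto
    define B where "B = a k0 \<union> Y"
    have B: "B \<subseteq> V" "B \<subseteq> a m" using sub[OF k0(1)] Y True chain_mono[OF a(1) k0(1)] unfolding B_def by auto
    \<comment> \<open>Each \<open>a k \<union> B\<close> is again some
      \<open>a j \<union> Y\<close>, so \<open>B\<close> has the least energy among them; by
      submodularity the intersection then has at most the energy of \<open>a k\<close>.\<close>
    have "F (a k \<inter> B) \<le> \<gamma>" if k: "k \<le> m" for k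
    proof -
      have "a k \<union> B = a (max k k0) \<union> Y"
        using chain_mono[OF a(1), of k k0] chain_mono[OF a(1), of k0 k] k k0(1)
        unfolding B_def by (cases "k \<le> k0") (auto simp: max_def)
      then have "F B \<le> F (a k \<union> B)" using k0 k unfolding B_def by (simp add: max_def)
      then show ?thesis using submodular[OF sub[OF k] B(1)] chain_height[OF a(1) k] by linarith
    qed
    then have "chain \<gamma> m (\<lambda>k. a k \<inter> B)" by (rule chain_Int[OF a(1)])
    moreover have "a m \<inter> B = B" using B by auto
    \<comment> \<open>Compare with index 0, where the union is \<open>Y\<close> itself.\<close>
    moreover have "F B \<le> F Y" using k0(2)[of 0] a(1) unfolding B_def chain_def by simp
    moreover have "Y \<subseteq> B" unfolding B_def by simp
    ultimately show ?thesis by (intro exI[of _ m] exI[of _ "\<lambda>k. a k \<inter> B"]) simp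
  next
    case False
    \<comment> \<open>Since \<open>X\<close> lies in \<open>a m\<close> and \<open>Y\<close> does
      not, the step adds a site. By submodularity this site costs no more on top of
      \<open>a m\<close> than on top of \<open>X\<close>.\<close>
    then obtain v where v: "v \<in> V" "v \<notin> X" "Y = insert v X" "v \<notin> a m"
      using step(2) a(2) unfolding step_def by auto
    have u: "a m \<union> Y = insert v (a m)" "a m \<inter> Y = X" using v a(2) by auto
    have le: "F (insert v (a m)) \<le> F Y" using submodular[OF sub[of m] Y(1)] a(3) unfolding u by simp
    define a' where "a' = a(Suc m := insert v (a m))"
    have "chain \<gamma> (Suc m) a'"
      unfolding a'_def using le Y by (intro chain_snoc a v) auto
    moreover have "a' (Suc m) = insert v (a m)" unfolding a'_def by simp
    ultimately show ?thesis using le v a(2)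
      by (intro exI[of _ "Suc m"] exI[of _ a'] conjI) auto
  qed
qed

section \<open>The critical nucleus\<close>

lemma full_chain: "\<exists>\<gamma> m a. chain \<gamma> m a \<and> supercritical (a m)"
proof -
  have "\<exists>m a. a 0 = {} \<and> (\<forall>k<m. \<exists>v\<in>V. a (Suc k) = a k \<or> a (Suc k) = insert v (a k)) \<and> a m = B"
    if "finite B" "B \<subseteq> V" for B
    using that
  proof (induction rule: finite_induct)
    case empty
    show ?case by (intro exI[of _ 0] exI[of _ "\<lambda>_. {}"]) simp
  next
    case (insert v B)
    then obtain m a where a: "a 0 = {}" "\<forall>k<m. \<exists>v\<in>V. a (Suc k) = a k \<or> a (Suc k) = insert v (a k)" "a m = B" by auto
    then show ?case using insert.prems
      by (intro exI[of _ "Suc m"] exI[of _ "a(Suc m := insert v B)"]) (auto simp: less_Suc_eq)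
  qed
  from this[OF finV] obtain m a where a: "a 0 = {}"
    "\<forall>k<m. \<exists>v\<in>V. a (Suc k) = a k \<or> a (Suc k) = insert v (a k)" "a m = V" by auto
  then have "chain (Max ((\<lambda>k. F (a k)) ` {..m})) m a" unfolding chain_def by auto
  moreover have "supercritical (a m)" using a(3) F_V V_ne unfolding supercritical_def by auto
  ultimately show ?thesis by blast
qed

text \<open>Two minimisations in this order: first the height over all chains with supercritical
  end, then the size of the end over the chains of that height. Only increasing chains compete;
  \<open>monotone_path\<close> shows that other paths do no better.\<close>

definition nucleus :: "real \<Rightarrow> nat \<Rightarrow> (nat \<Rightarrow> 'v set) \<Rightarrow> bool" where
  "nucleus \<Gamma> m a \<longleftrightarrow> chain \<Gamma> m a \<and> supercritical (a m) \<and>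
     (\<forall>n b. chain \<Gamma> n b \<and> supercritical (b n) \<longrightarrow> card (a m) \<le> card (b n)) \<and>
     (\<forall>\<gamma> n b. chain \<gamma> n b \<and> supercritical (b n) \<longrightarrow> \<Gamma> \<le> \<gamma>)"

text \<open>The least height is attained because any height can be lowered to the largest energy met
  by the chain, one of finitely many values of \<open>F\<close>.\<close>

lemma ex_nucleus: "\<exists>\<Gamma> m a. nucleus \<Gamma> m a"
proof -
  define G where "G = {\<gamma> \<in> F ` Pow V. \<exists>m a. chain \<gamma> m a \<and> supercritical (a m)}"
  have finG: "finite G" unfolding G_def using finV by simp
  have low: "\<exists>\<gamma>'\<in>G. \<gamma>' \<le> \<gamma>" if "chain \<gamma> m a" "supercritical (a m)" for \<gamma> m a
  proof -
    define \<gamma>' where "\<gamma>' = Max ((\<lambda>k. F (a k)) ` {..m})"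
    have "\<gamma>' \<in> (\<lambda>k. F (a k)) ` {..m}" unfolding \<gamma>'_def by (rule Max_in) auto
    then obtain k where k: "k \<le> m" "\<gamma>' = F (a k)" by auto
    have "chain \<gamma>' m a" using that(1) unfolding chain_def \<gamma>'_def by auto
    then have "\<gamma>' \<in> G" using that chain_subset[OF that(1) k(1)] k(2) unfolding G_def by auto
    moreover have "\<gamma>' \<le> \<gamma>" using chain_height[OF that(1) k(1)] k(2) by simp
    ultimately show ?thesis by blast
  qed
  have neG: "G \<noteq> {}" using full_chain low by blast
  define \<Gamma> where "\<Gamma> = Min G"
  have \<Gamma>: "\<Gamma> \<in> G" unfolding \<Gamma>_def using finG neG by simp
  have min: "\<Gamma> \<le> \<gamma>" if "chain \<gamma> m a" "supercritical (a m)" for \<gamma> m a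
  proof -
    obtain g where "g \<in> G" "g \<le> \<gamma>" using low[OF \<open>chain \<gamma> m a\<close> \<open>supercritical (a m)\<close>] by blast
    moreover from this have "\<Gamma> \<le> g" unfolding \<Gamma>_def using finG by simp
    ultimately show ?thesis by simp
  qed
  have "\<exists>c m a. chain \<Gamma> m a \<and> supercritical (a m) \<and> card (a m) = c" using \<Gamma> unfolding G_def by auto
  then obtain c where c: "\<exists>m a. chain \<Gamma> m a \<and> supercritical (a m) \<and> card (a m) = c"
    and cmin: "\<And>c'. c' < c \<Longrightarrow> \<not> (\<exists>m a. chain \<Gamma> m a \<and> supercritical (a m) \<and> card (a m) = c')"
    using exists_least_iff[of "\<lambda>c. \<exists>m a. chain \<Gamma> m a \<and> supercritical (a m) \<and> card (a m) = c"] by blast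
  obtain m a where "chain \<Gamma> m a" "supercritical (a m)" "card (a m) = c" using c by blast
  moreover from this have "\<forall>n b. chain \<Gamma> n b \<and> supercritical (b n) \<longrightarrow> card (a m) \<le> card (b n)"
    using cmin not_le by blast
  ultimately show ?thesis using min unfolding nucleus_def by blast
qed

lemma nucleus_pos:
  assumes "nucleus \<Gamma> m a" shows "\<Gamma> > 0"
proof -
  have a: "chain \<Gamma> m a" "a m \<noteq> {}" using assms unfolding nucleus_def supercritical_def by auto
  obtain v k where "v \<in> V" "k \<le> m" "a k = {v}" using chain_first[OF a] by blast
  then show ?thesis using F_single[of v] chain_height[OF a(1), of k] by simp
qed

text \<open>A site isolated in \<open>a m\<close> is isolated in every member of the chain that
  contains it. Deleting it throughout keeps the height and leaves a smaller supercritical end,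
  against minimality.\<close>

lemma nucleus_neighbour:
  assumes n: "nucleus \<Gamma> m a" and v: "v \<in> a m"
  shows "\<exists>y\<in>a m. nb v y"
proof (rule ccontr)
  assume *: "\<not> (\<exists>y\<in>a m. nb v y)"
  have a: "chain \<Gamma> m a" "supercritical (a m)"
    and min: "\<And>n b. chain \<Gamma> n b \<Longrightarrow> supercritical (b n) \<Longrightarrow> card (a m) \<le> card (b n)"
    using n unfolding nucleus_def by auto
  have am: "a m \<subseteq> V" "finite (a m)" using chain_subset[OF a(1), of m] finV finite_subset by auto
  have drop: "F (a k - {v}) \<le> F (a k)" if k: "k \<le> m" for k
  proof (cases "v \<in> a k")
    case True
    have "a k \<subseteq> a m" using chain_mono[OF a(1) k] by simp
    then show ?thesis using True * am by (intro F_isolated) auto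
  qed simp
  have "F (a k \<inter> - {v}) \<le> \<Gamma>" if "k \<le> m" for k
    using drop[OF that] chain_height[OF a(1) that] by (simp add: Diff_eq)
  then have c: "chain \<Gamma> m (\<lambda>k. a k \<inter> - {v})" by (rule chain_Int[OF a(1)])
  have "a m - {v} \<noteq> {}"
  proof
    assume "a m - {v} = {}"
    then have "a m = {v}" using v by auto
    then show False using a(2) F_single[of v] am unfolding supercritical_def by auto
  qed
  then have "supercritical (a m \<inter> - {v})"
    using a(2) drop[of m] unfolding supercritical_def by (auto simp: Diff_eq)
  from min[OF c this] have "card (a m) \<le> card (a m - {v})" by (simp add: Diff_eq)
  then show False using v am(2) card_Diff1_less[of "a m" v] by simp
qed

text \<open>Starting a copy of the nucleus inside \<open>\<eta>\<close>, with a neighbour of its first site outside \<open>\<eta>\<close>, and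
  growing it on top of \<open>\<eta>\<close> costs strictly less than \<open>\<Gamma>\<close> by submodularity, since by minimality of the
  nucleus its intersections with \<open>\<eta>\<close> have positive energy until the energy has dropped.\<close>

lemma descent:
  assumes n: "nucleus \<Gamma> m a" and \<eta>: "\<eta> \<subseteq> V" "\<eta> \<noteq> {}" "\<eta> \<noteq> V"
  shows "\<exists>n b. b 0 = \<eta> \<and> (\<forall>k<n. \<exists>v\<in>V. b (Suc k) = b k \<or> b (Suc k) = insert v (b k)) \<and>
    (\<forall>k\<le>n. b k \<subseteq> V \<and> F (b k) < F \<eta> + \<Gamma>) \<and> F (b n) < F \<eta>"
proof -
  have a: "chain \<Gamma> m a" "supercritical (a m)"
    and min: "\<And>n b. chain \<Gamma> n b \<Longrightarrow> supercritical (b n) \<Longrightarrow> card (a m) \<le> card (b n)"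
    using n unfolding nucleus_def by auto
  obtain z where z: "z \<in> V" "z \<in> a m" "\<And>k. k \<le> m \<Longrightarrow> a k \<noteq> {} \<Longrightarrow> z \<in> a k"
    using chain_first[OF a(1)] a(2) unfolding supercritical_def by blast
  obtain z' where z': "z' \<in> a m" "nb z z'" using nucleus_neighbour[OF n z(2)] by blast
  obtain x y where xy: "x \<in> \<eta>" "y \<in> V" "y \<notin> \<eta>" "nb x y" using boundary[OF \<eta>] by auto
  obtain g where g: "bij_betw g V V" "g z = x" "g z' = y" "\<forall>A\<subseteq>V. F (g ` A) = F A"
    using arc_transitive[of z z' x y] z(1) z' xy \<eta>(1) chain_subset[OF a(1), of m] by blast
  define c where "c k = g ` a k" for k
  have c: "chain \<Gamma> m c" unfolding c_def by (rule chain_image[OF a(1) g(1,4)])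
  have sub: "c k \<subseteq> V" if "k \<le> m" for k using chain_subset[OF c that] .
  have am: "a m \<subseteq> V" "finite (a m)" using chain_subset[OF a(1), of m] finV finite_subset by auto
  have cardc: "card (c m) = card (a m)"
    unfolding c_def using g(1) am(1) by (intro card_image) (auto simp: bij_betw_def inj_on_subset)
  have "supercritical (c m)"
    using a(2) g(4) sub[of m] unfolding supercritical_def c_def by auto
  have meet: "c k \<inter> \<eta> \<noteq> {}" if "k \<le> m" "c k \<noteq> {}" for k
    using z(3)[OF that(1)] that(2) g(2) xy(1) unfolding c_def by auto
  have small: "card (c k \<inter> \<eta>) < card (a m)" if k: "k \<le> m" for k
  proof -
    have "c k \<inter> \<eta> \<subseteq> c m - {y}" using chain_mono[OF c k] xy by auto
    moreover have "y \<in> c m" using z' g unfolding c_def by auto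
    moreover have "finite (c m)" using am unfolding c_def by simp
    ultimately have "card (c k \<inter> \<eta>) < card (c m)" by (intro psubset_card_mono) auto
    then show ?thesis using cardc by simp
  qed
  have submod: "F (\<eta> \<union> c k) + F (c k \<inter> \<eta>) \<le> F \<eta> + F (c k)" if "k \<le> m" for k
    using submodular[OF \<eta>(1) sub[OF that]] by (simp add: Int_commute)
  \<comment> \<open>If no such \<open>i\<close> existed, \<open>submod\<close> would bound the
    energy of each intersection by that of \<open>c k\<close>, so the intersections would form a
    chain of height \<open>\<Gamma>\<close>. Being smaller than the nucleus, none is supercritical,
    so the nonempty ones have positive energy; at the end \<open>c m\<close>, of energy at most 0,
    this forces the drop after all.\<close>
  have ex: "\<exists>i\<le>m. F (\<eta> \<union> c i) < F \<eta> \<and> (\<forall>k<i. c k = {} \<or> F (c k \<inter> \<eta>) > 0)"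
  proof (rule ccontr)
    assume contra: "\<not> ?thesis"
    have pos: "F (c j \<inter> \<eta>) > 0" if "j \<le> m" "c j \<noteq> {}" for j
      using that
    proof (induction j rule: less_induct)
      case (less j)
      have "F (\<eta> \<union> c i) \<ge> F \<eta>" if "i \<le> j" for i
      proof -
        have "\<forall>k<i. c k = {} \<or> F (c k \<inter> \<eta>) > 0"
          using less.IH less.prems(1) that by (meson le_trans less_imp_le less_le_trans)
        then show ?thesis using contra less.prems(1) that by (meson le_trans not_le)
      qed
      then have "F (c i \<inter> \<eta>) \<le> F (c i)" if "i \<le> j" for i
        using submod[of i] that less.prems(1) by force
      then have "F (c i \<inter> \<eta>) \<le> \<Gamma>" if "i \<le> j" for i
        using chain_height[OF c, of i] that less.prems(1) by force
      then have "chain \<Gamma> j (\<lambda>k. c k \<inter> \<eta>)"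
        by (intro chain_Int[OF chain_prefix[OF c less.prems(1)]]) auto
      then have "\<not> supercritical (c j \<inter> \<eta>)" using min[of j "\<lambda>k. c k \<inter> \<eta>"] small[OF less.prems(1)] by auto
      then show ?case using meet[OF less.prems] \<eta>(1) unfolding supercritical_def by auto
    qed
    have "c m \<noteq> {}" "F (c m) \<le> 0" using \<open>supercritical (c m)\<close> unfolding supercritical_def by auto
    then have "F (\<eta> \<union> c m) < F \<eta>" using pos[of m] submod[of m] by simp
    then show False using contra pos by (metis le_refl less_imp_le)
  qed
  then obtain i where i: "i \<le> m" "F (\<eta> \<union> c i) < F \<eta>" "\<And>k. k < i \<Longrightarrow> c k = {} \<or> F (c k \<inter> \<eta>) > 0" by blast
  have height: "F (\<eta> \<union> c k) < F \<eta> + \<Gamma>" if "k \<le> i" for k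
  proof (cases "k = i")
    case True then show ?thesis using i(2) nucleus_pos[OF n] by simp
  next
    case False
    then have "c k = {} \<or> F (c k \<inter> \<eta>) > 0" using i(3) that by simp
    then show ?thesis
      using submod[of k] chain_height[OF c, of k] nucleus_pos[OF n] i(1) that by fastforce
  qed
  show ?thesis
  proof (intro exI[of _ i] exI[of _ "\<lambda>k. \<eta> \<union> c k"] conjI allI impI)
    show "\<eta> \<union> c 0 = \<eta>" using c by (simp add: chain_def)
    fix k assume "k < i"
    then obtain v where "v \<in> V" "c (Suc k) = c k \<or> c (Suc k) = insert v (c k)"
      using chain_Suc[OF c, of k] i(1) by (meson less_le_trans)
    then show "\<exists>v\<in>V. \<eta> \<union> c (Suc k) = \<eta> \<union> c k \<or> \<eta> \<union> c (Suc k) = insert v (\<eta> \<union> c k)" by auto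
  qed (use height i sub \<eta> in auto)
qed

section \<open>Energy gap and relaxation\<close>

lemma ex_gap: "\<exists>\<delta>>0. \<forall>A\<subseteq>V. \<forall>B\<subseteq>V. F A < F B + \<Gamma> \<longrightarrow> F A \<le> F B + \<Gamma> - \<delta>"
proof -
  define D where "D = {d \<in> (\<lambda>(A, B). F B + \<Gamma> - F A) ` (Pow V \<times> Pow V). d > 0}"
  have fin: "finite (insert 1 D)" unfolding D_def using finV by simp
  \<comment> \<open>The element 1 keeps the minimum defined when \<open>D\<close> is empty.\<close>
  define \<delta> where "\<delta> = Min (insert 1 D)"
  have "\<delta> > 0" unfolding \<delta>_def using fin by (subst Min_gr_iff) (auto simp: D_def)
  moreover have "F A \<le> F B + \<Gamma> - \<delta>" if "A \<subseteq> V" "B \<subseteq> V" "F A < F B + \<Gamma>" for A B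
  proof -
    have "F B + \<Gamma> - F A \<in> insert 1 D" using that unfolding D_def by auto
    then have "\<delta> \<le> F B + \<Gamma> - F A" unfolding \<delta>_def using fin by (intro Min_le)
    then show ?thesis by simp
  qed
  ultimately show ?thesis by blast
qed

lemma walk_steps:
  assumes "\<forall>k<n. \<exists>v\<in>V. b (Suc k) = b k \<or> b (Suc k) = insert v (b k)"
    and "\<forall>k\<le>n. b k \<subseteq> V \<and> F (b k) \<le> \<theta>" and "k \<le> n"
  shows "(step \<theta>)\<^sup>*\<^sup>* (b 0) (b k)"
  using assms(3)
proof (induction k)
  case (Suc k)
  then obtain v where v: "v \<in> V" "b (Suc k) = b k \<or> b (Suc k) = insert v (b k)"
    using assms(1) by (meson Suc_le_lessD)
  show ?case
  proof (cases "b (Suc k) = b k")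
    case True then show ?thesis using Suc by simp
  next
    case False
    then have "step \<theta> (b k) (b (Suc k))"
      using v assms(2) Suc.prems unfolding step_def by (auto simp: insert_absorb)
    then show ?thesis using Suc by (meson Suc_leD rtranclp.rtrancl_into_rtrancl)
  qed
qed simp

lemma step_mono: "\<theta> \<le> \<theta>' \<Longrightarrow> (step \<theta>)\<^sup>*\<^sup>* A B \<Longrightarrow> (step \<theta>')\<^sup>*\<^sup>* A B"
  by (erule rtranclp_mono[THEN predicate2D, rotated]) (auto simp: step_def)

theorem metastable_landscape:
  obtains \<Gamma> \<delta> where "0 < \<delta>" "\<delta> \<le> \<Gamma>"
    and "\<And>\<gamma>. \<gamma> < \<Gamma> \<Longrightarrow> 0 \<le> \<gamma> \<Longrightarrow> \<not> (step \<gamma>)\<^sup>*\<^sup>* {} V"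
    and "\<And>\<eta>. \<eta> \<subseteq> V \<Longrightarrow> \<exists>\<zeta>\<in>{{}, V}. (step (F \<eta> + \<Gamma> - \<delta>))\<^sup>*\<^sup>* \<eta> \<zeta>"
proof -
  obtain \<Gamma> m a where n: "nucleus \<Gamma> m a" using ex_nucleus by blast
  obtain \<delta> where "\<delta> > 0" and
    gap: "\<forall>A\<subseteq>V. \<forall>B\<subseteq>V. F A < F B + \<Gamma> \<longrightarrow> F A \<le> F B + \<Gamma> - \<delta>"
    using ex_gap[of \<Gamma>] by (elim exE conjE)
  note \<delta> = this(1) gap[rule_format]
  have \<Gamma>\<delta>: "\<delta> \<le> \<Gamma>" using \<delta>(2)[of "{}" "{}"] nucleus_pos[OF n] by simp
  have no_path: "\<not> (step \<gamma>)\<^sup>*\<^sup>* {} V" if \<gamma>: "\<gamma> < \<Gamma>" "0 \<le> \<gamma>" for \<gamma>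
  proof
    assume "(step \<gamma>)\<^sup>*\<^sup>* {} V"
    then obtain k b where b: "chain \<gamma> k b" "V \<subseteq> b k" "F (b k) \<le> F V" using monotone_path[OF _ \<gamma>(2)] by blast
    then have "supercritical (b k)"
      using F_V V_ne chain_subset[OF b(1), of k] unfolding supercritical_def by auto
    then show False using n b(1) \<gamma>(1) unfolding nucleus_def by (meson not_le)
  qed
  have "\<exists>\<zeta>\<in>{{}, V}. (step (F \<eta> + \<Gamma> - \<delta>))\<^sup>*\<^sup>* \<eta> \<zeta>" if \<eta>: "\<eta> \<subseteq> V" for \<eta>
  proof -
    define \<theta> where "\<theta> = F \<eta> + \<Gamma> - \<delta>"
    \<comment> \<open>Requiring \<open>F \<zeta> \<le> F \<eta>\<close> keeps a further descent from
      \<open>\<zeta>\<close> below the level \<open>\<theta>\<close>, which is fixed by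
      \<open>\<eta>\<close>.\<close>
    define Z where "Z = {\<zeta>. \<zeta> \<subseteq> V \<and> F \<zeta> \<le> F \<eta> \<and> (step \<theta>)\<^sup>*\<^sup>* \<eta> \<zeta>}"
    have "finite Z" "Z \<noteq> {}" unfolding Z_def using finV \<eta> by auto
    then obtain \<zeta> where \<zeta>: "\<zeta> \<in> Z" "\<And>\<zeta>'. \<zeta>' \<in> Z \<Longrightarrow> F \<zeta> \<le> F \<zeta>'"
      using ex_is_arg_min_if_finite[of Z F] unfolding is_arg_min_linorder by auto
    have "\<zeta> \<in> {{}, V}"
    proof (rule ccontr)
      assume "\<zeta> \<notin> {{}, V}"
      then obtain k b where b: "b 0 = \<zeta>" "\<forall>j<k. \<exists>v\<in>V. b (Suc j) = b j \<or> b (Suc j) = insert v (b j)"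
        "\<forall>j\<le>k. b j \<subseteq> V \<and> F (b j) < F \<zeta> + \<Gamma>" "F (b k) < F \<zeta>"
        using descent[OF n, of \<zeta>] \<zeta>(1) unfolding Z_def by auto
      have "\<forall>j\<le>k. b j \<subseteq> V \<and> F (b j) \<le> \<theta>"
      proof (intro allI impI)
        fix j assume "j \<le> k"
        then have "b j \<subseteq> V" "F (b j) \<le> F \<zeta> + \<Gamma> - \<delta>" using b(3) \<delta>(2)[of "b j" \<zeta>] \<zeta>(1) unfolding Z_def by auto
        then show "b j \<subseteq> V \<and> F (b j) \<le> \<theta>" using \<zeta>(1) unfolding Z_def \<theta>_def by auto
      qed
      from walk_steps[OF b(2) this, of k] have "(step \<theta>)\<^sup>*\<^sup>* \<zeta> (b k)" using b(1) by simp
      then have "(step \<theta>)\<^sup>*\<^sup>* \<eta> (b k)" using \<zeta>(1) unfolding Z_def by (blast intro: rtranclp_trans)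
      then have "b k \<in> Z" using b(3,4) \<zeta>(1) unfolding Z_def by auto
      then show False using \<zeta>(2) b(4) by (meson not_le)
    qed
    then show ?thesis using \<zeta>(1) unfolding Z_def \<theta>_def by blast
  qed
  with \<delta>(1) \<Gamma>\<delta> no_path show ?thesis by (rule that)
qed

lemma step_to_full:
  assumes "\<And>A. A \<subseteq> V \<Longrightarrow> F A \<le> \<theta>" "\<eta> \<subseteq> V"
  shows "(step \<theta>)\<^sup>*\<^sup>* \<eta> V"
proof -
  have "(step \<theta>)\<^sup>*\<^sup>* \<eta> (\<eta> \<union> B)" if "finite B" "B \<subseteq> V" for B
    using that
  proof (induction rule: finite_induct)
    case (insert v B)
    show ?case
    proof (cases "v \<in> \<eta> \<union> B")
      case True then show ?thesis using insert by (simp add: insert_absorb)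
    next
      case False
      then have "step \<theta> (\<eta> \<union> B) (\<eta> \<union> insert v B)"
        using insert.prems assms unfolding step_def by auto
      then show ?thesis using insert by (meson insert_subset rtranclp.rtrancl_into_rtrancl)
    qed
  qed simp
  from this[OF finV] show ?thesis using assms(2) by (simp add: Un_absorb1)
qed

end

section \<open>Metropolis dynamics on a landscape\<close>

context landscape
begin

section \<open>The Metropolis kernel and detailed balance\<close>

definition toggle :: "'v \<Rightarrow> 'v set \<Rightarrow> 'v set" where
  "toggle v A = (if v \<in> A then A - {v} else insert v A)"

definition off :: "real \<Rightarrow> 'v set \<Rightarrow> 'v set \<Rightarrow> real" where
  "off \<beta> A B = (if B \<noteq> A \<and> (\<exists>v\<in>V. B = toggle v A)
     then exp (- \<beta> * max 0 (F B - F A)) / real (card V) else 0)"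

definition kernel :: "real \<Rightarrow> 'v set \<Rightarrow> 'v set \<Rightarrow> real" where
  "kernel \<beta> A B = (if B = A then 1 - (\<Sum>C\<in>Pow V - {A}. off \<beta> A C) else off \<beta> A B)"

abbreviation survival :: "real \<Rightarrow> 'v set set \<Rightarrow> nat \<Rightarrow> 'v set \<Rightarrow> real" where
  "survival \<beta> \<equiv> reversible_chain.surv (Pow V) (kernel \<beta>)"

lemma toggle_toggle: "toggle v (toggle v A) = A"
  unfolding toggle_def by auto

lemma toggle_sym: "(\<exists>v\<in>V. B = toggle v A) \<longleftrightarrow> (\<exists>v\<in>V. A = toggle v B)"
  by (metis toggle_toggle)

lemma card_V: "real (card V) > 0"
  using finV V_ne by (simp add: card_gt_0_iff)

lemma off_nonneg: "off \<beta> A B \<ge> 0"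
  unfolding off_def by simp

lemma off_le: "\<beta> > 0 \<Longrightarrow> off \<beta> A B \<le> 1 / real (card V)"
  unfolding off_def by (auto intro!: divide_right_mono mult_nonneg_nonneg)

lemma sum_off_le:
  assumes "\<beta> > 0" shows "(\<Sum>C\<in>Pow V - {A}. off \<beta> A C) \<le> 1"
proof -
  let ?N = "(\<lambda>v. toggle v A) ` V"
  have "(\<Sum>C\<in>Pow V - {A}. off \<beta> A C) = (\<Sum>C\<in>(Pow V - {A}) \<inter> ?N. off \<beta> A C)"
    using finV by (intro sum.mono_neutral_right) (auto simp: off_def)
  also have "\<dots> \<le> (\<Sum>C\<in>?N. off \<beta> A C)"
    using finV by (intro sum_mono2) (auto simp: off_nonneg)
  also have "\<dots> \<le> real (card ?N) * (1 / real (card V))"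
    by (rule sum_bounded_above) (rule off_le[OF assms])
  also have "\<dots> \<le> real (card V) * (1 / real (card V))"
    using finV by (intro mult_right_mono) (auto simp: card_image_le)
  finally show ?thesis using card_V by simp
qed

text \<open>The flux depends only on the larger of the two energies. This symmetry is detailed
  balance, and it bounds the flux below along paths of bounded height.\<close>

lemma weighted_off:
  "exp (- \<beta> * F A) * off \<beta> A B = (if B \<noteq> A \<and> (\<exists>v\<in>V. B = toggle v A)
     then exp (- \<beta> * max (F A) (F B)) / real (card V) else 0)"
proof -
  have "exp (- \<beta> * F A) * exp (- \<beta> * max 0 (F B - F A)) = exp (- \<beta> * max (F A) (F B))"
    unfolding exp_add[symmetric] by (simp add: max_def algebra_simps)
  then show ?thesis unfolding off_def by simp
qed

lemma reversible_metropolis: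
  assumes \<beta>: "\<beta> > 0"
  shows "reversible_chain (Pow V) (kernel \<beta>) (\<lambda>A. exp (- \<beta> * F A))"
proof
  show "finite (Pow V)" using finV by simp
  fix A assume A: "A \<in> Pow V"
  show "0 < exp (- \<beta> * F A)" by simp
  have "(\<Sum>B\<in>Pow V. kernel \<beta> A B) = kernel \<beta> A A + (\<Sum>B\<in>Pow V - {A}. kernel \<beta> A B)"
    using A finV by (subst sum.remove[of _ A]) auto
  also have "(\<Sum>B\<in>Pow V - {A}. kernel \<beta> A B) = (\<Sum>B\<in>Pow V - {A}. off \<beta> A B)"
    by (intro sum.cong) (auto simp: kernel_def)
  finally show "(\<Sum>B\<in>Pow V. kernel \<beta> A B) = 1" by (simp add: kernel_def)
  fix B assume B: "B \<in> Pow V"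
  show "0 \<le> kernel \<beta> A B" using sum_off_le[OF \<beta>] off_nonneg unfolding kernel_def by auto
  have "exp (- \<beta> * F A) * off \<beta> A B = exp (- \<beta> * F B) * off \<beta> B A"
    unfolding weighted_off by (simp only: max.commute[of "F A" "F B"] toggle_sym[of B A] eq_commute[of A B])
  then show "exp (- \<beta> * F A) * kernel \<beta> A B = exp (- \<beta> * F B) * kernel \<beta> B A"
    unfolding kernel_def by auto
qed

lemma step_conductance:
  assumes "step \<theta> A B" "\<beta> > 0"
  shows "exp (- \<beta> * \<theta>) / real (card V) \<le> exp (- \<beta> * F A) * kernel \<beta> A B"
proof -
  have "B \<noteq> A" "\<exists>v\<in>V. B = toggle v A" using assms(1) unfolding step_def toggle_def by auto
  then have "exp (- \<beta> * F A) * kernel \<beta> A B = exp (- \<beta> * max (F A) (F B)) / real (card V)"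
    unfolding kernel_def using weighted_off[of \<beta> A B] by simp
  moreover have "- \<beta> * \<theta> \<le> - \<beta> * max (F A) (F B)" using assms unfolding step_def by simp
  ultimately show ?thesis using card_V by (simp add: divide_right_mono)
qed

text \<open>The relation may depend on the start, as the admissible level does, but not on \<beta>;
  hence one length bound serves all temperatures.\<close>

lemma bounded_paths:
  assumes "finite S" "\<And>x. x \<in> S \<Longrightarrow> \<exists>y\<in>A. (r x)\<^sup>*\<^sup>* x y"
  shows "\<exists>l\<ge>1::nat. \<forall>x\<in>S. \<exists>n\<le>l. \<exists>y\<in>A. (r x ^^ n) x y"
proof -
  have "\<forall>x\<in>S. \<exists>n. \<exists>y\<in>A. (r x ^^ n) x y" using assms(2) rtranclp_imp_relpowp by meson
  then obtain n where n: "\<forall>x\<in>S. \<exists>y\<in>A. (r x ^^ n x) x y" by metis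
  define l where "l = Max (insert 1 (n ` S))"
  have "n x \<le> l" if "x \<in> S" for x unfolding l_def using assms(1) that by (intro Max_ge) auto
  moreover have "1 \<le> l" unfolding l_def using assms(1) by (intro Max_ge) auto
  ultimately show ?thesis using n by blast
qed

section \<open>Relaxation and escape rates\<close>

lemma F_bounded: obtains M where "M \<ge> 0" "\<And>A. A \<subseteq> V \<Longrightarrow> \<bar>F A\<bar> \<le> M"
proof
  have fin: "finite ((\<lambda>A. \<bar>F A\<bar>) ` Pow V)" using finV by simp
  show "\<bar>F A\<bar> \<le> Max ((\<lambda>A. \<bar>F A\<bar>) ` Pow V)" if "A \<subseteq> V" for A
    using fin that by (intro Max_ge) auto
  from this[of "{}"] show "0 \<le> Max ((\<lambda>A. \<bar>F A\<bar>) ` Pow V)" by (simp add: F_empty)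
qed

lemma survival_decay:
  assumes A: "A \<subseteq> Pow V"
    and paths: "\<And>\<eta>. \<eta> \<in> Pow V - A \<Longrightarrow> \<exists>\<zeta>\<in>A. (step (F \<eta> + U))\<^sup>*\<^sup>* \<eta> \<zeta>"
  shows "\<exists>K M. K > 0 \<and> (\<forall>\<beta> n. \<forall>\<eta>\<in>Pow V - A. \<beta> > 0 \<longrightarrow>
    survival \<beta> A n \<eta> \<le> exp (\<beta> * M + K - exp (- \<beta> * U) / K * real n))"
proof -
  have finS: "finite (Pow V - A)" using finV by simp
  obtain l :: nat where l: "l \<ge> 1" "\<forall>\<eta>\<in>Pow V - A. \<exists>n\<le>l. \<exists>\<zeta>\<in>A. (step (F \<eta> + U) ^^ n) \<eta> \<zeta>"
    using bounded_paths[where r = "\<lambda>\<eta>. step (F \<eta> + U)", OF finS paths] by blast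
  obtain M where M: "M \<ge> 0" "\<And>A. A \<subseteq> V \<Longrightarrow> \<bar>F A\<bar> \<le> M" using F_bounded by blast
  define N where "N = real (card (Pow V))"
  have N: "N \<ge> 1" unfolding N_def card_Pow[OF finV] by simp
  \<comment> \<open>The squared survival probability decays at rate
    \<open>exp (- \<beta> * U) / (2 * real (card V) * N * real l ^ 2)\<close>; the square root
    halves it, whence the 4. The same \<open>K\<close> absorbs the number \<open>N\<close> of states
    into \<open>exp (2 * K)\<close>.\<close>
  define K where "K = 4 * real (card V) * N * real l ^ 2"
  have cV: "real (card V) \<ge> 1" using card_V by simp
  have "1 \<le> real l ^ 2" using l(1) by simp
  then have "1 * 1 \<le> real (card V) * real l ^ 2" using cV by (intro mult_mono) auto
  then have "N * 1 \<le> N * (real (card V) * real l ^ 2)" using N by (intro mult_left_mono) auto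
  then have K: "K > 0" "N \<le> K" using N unfolding K_def by (auto simp: algebra_simps)
  have "survival \<beta> A n \<eta> \<le> exp (\<beta> * M + K - exp (- \<beta> * U) / K * real n)"
    if \<beta>: "\<beta> > 0" and \<eta>: "\<eta> \<in> Pow V - A" for \<beta> n \<eta>
  proof -
    interpret reversible_chain "Pow V" "kernel \<beta>" "\<lambda>A. exp (- \<beta> * F A)"
      by (rule reversible_metropolis[OF \<beta>])
    define c where "c = exp (- \<beta> * U) / real (card V)"
    have c: "c > 0" unfolding c_def using card_V by simp
    define r where "r \<xi> = (\<lambda>a b. a \<in> Pow V \<and> b \<in> Pow V \<and>
      exp (- \<beta> * F a) * kernel \<beta> a b \<ge> c * exp (- \<beta> * F \<xi>))" for \<xi>
    have edge: "r \<xi> a b" if "step (F \<xi> + U) a b" for \<xi> a b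
    proof -
      have "c * exp (- \<beta> * F \<xi>) = exp (- \<beta> * (F \<xi> + U)) / real (card V)"
        unfolding c_def by (simp add: exp_add[symmetric] algebra_simps)
      then show ?thesis using step_conductance[OF that \<beta>] that unfolding r_def step_def by simp
    qed
    have walk: "(r \<xi> ^^ n) a b" if "(step (F \<xi> + U) ^^ n) a b" for \<xi> n a b
      using that by (induction n arbitrary: b) (auto dest: edge)
    have pp: "\<exists>n\<le>l. \<exists>y\<in>A. (r x ^^ n) x y" if "x \<in> Pow V - A" for x
      using l(2) that walk by meson
    define \<kappa> where "\<kappa> = c / (2 * real (card (Pow V)) * real l ^ 2)"
    have \<kappa>: "\<kappa> = 2 * (exp (- \<beta> * U) / K)" unfolding \<kappa>_def c_def K_def N_def by simp
    have Fle: "- \<beta> * F x \<le> \<beta> * M" "- (\<beta> * M) \<le> - \<beta> * F x" if "x \<subseteq> V" for x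
      using M(2)[OF that] mult_left_mono[of "- F x" M \<beta>] mult_left_mono[of "F x" M \<beta>] \<beta> by auto
    have "exp (- \<beta> * F \<eta>) * (surv A n \<eta>)\<^sup>2 \<le> exp (- \<kappa> * real n) * (\<Sum>x\<in>Pow V. exp (- \<beta> * F x))"
    proof (rule surv_decay[OF A _ \<eta>])
      fix f :: "'v set \<Rightarrow> real" assume f: "\<And>x. x \<in> A \<Longrightarrow> f x = 0"
      show "2 * \<kappa> * (\<Sum>x\<in>Pow V. exp (- \<beta> * F x) * (f x)\<^sup>2) \<le> energy f"
        unfolding \<kappa>_def by (rule poincare_paths[OF c l(1) pp[unfolded r_def] f])
    qed
    also have "(\<Sum>x\<in>Pow V. exp (- \<beta> * F x)) \<le> (\<Sum>x\<in>Pow V. exp (\<beta> * M))"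
      using Fle by (intro sum_mono) auto
    also have "\<dots> = N * exp (\<beta> * M)" unfolding N_def by simp
    finally have 1: "exp (- \<beta> * F \<eta>) * (surv A n \<eta>)\<^sup>2 \<le> exp (- \<kappa> * real n) * (N * exp (\<beta> * M))" by simp
    have NK: "N \<le> exp (2 * K)" using K N exp_ge_add_one_self[of "2 * K"] by linarith
    have "exp (- (\<beta> * M)) * (surv A n \<eta>)\<^sup>2 \<le> exp (- \<beta> * F \<eta>) * (surv A n \<eta>)\<^sup>2"
      using Fle(2)[of \<eta>] \<eta> by (intro mult_right_mono) auto
    also note 1
    also have "exp (- \<kappa> * real n) * (N * exp (\<beta> * M)) \<le> exp (- \<kappa> * real n) * (exp (2 * K) * exp (\<beta> * M))"
      using NK by (intro mult_left_mono mult_right_mono) auto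
    finally have "exp (\<beta> * M) * (exp (- (\<beta> * M)) * (surv A n \<eta>)\<^sup>2)
        \<le> exp (\<beta> * M) * (exp (- \<kappa> * real n) * (exp (2 * K) * exp (\<beta> * M)))" by (intro mult_left_mono) auto
    then have "(surv A n \<eta>)\<^sup>2 \<le> exp (\<beta> * M + (- \<kappa> * real n + (2 * K + \<beta> * M)))"
      unfolding mult.assoc[symmetric] exp_add[symmetric] by (simp add: add.assoc)
    also have "\<beta> * M + (- \<kappa> * real n + (2 * K + \<beta> * M)) = 2 * (\<beta> * M + K - exp (- \<beta> * U) / K * real n)"
      unfolding \<kappa> by (simp add: algebra_simps)
    also have "exp \<dots> = (exp (\<beta> * M + K - exp (- \<beta> * U) / K * real n))\<^sup>2"
      by (rule exp_double)
    finally show ?thesis by (rule power2_le_imp_le) simp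
  qed
  with K(1) show ?thesis by blast
qed

text \<open>An edge leaving the valley \<open>W\<close> of sets reachable strictly below
  \<open>\<Gamma>\<close> must end at energy at least \<open>\<Gamma>\<close>, as otherwise its end
  would belong to \<open>W\<close>. So its flux is at most
  \<open>exp (- \<beta> * \<Gamma>)\<close>; the squared cardinality counts pairs of states, and
  \<open>{}\<close> has weight 1.\<close>

lemma escape_slow:
  assumes \<Gamma>: "\<Gamma> > 0" and no_path: "\<And>\<gamma>. \<gamma> < \<Gamma> \<Longrightarrow> 0 \<le> \<gamma> \<Longrightarrow> \<not> (step \<gamma>)\<^sup>*\<^sup>* {} V" and \<beta>: "\<beta> > 0"
  shows "1 - survival \<beta> {V} n {} \<le> real n * (real (card (Pow V)) ^ 2 * exp (- \<beta> * \<Gamma>))"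
proof -
  interpret reversible_chain "Pow V" "kernel \<beta>" "\<lambda>A. exp (- \<beta> * F A)"
    by (rule reversible_metropolis[OF \<beta>])
  define W where "W = {A. A \<subseteq> V \<and> (\<exists>\<gamma><\<Gamma>. 0 \<le> \<gamma> \<and> F A \<le> \<gamma> \<and> (step \<gamma>)\<^sup>*\<^sup>* {} A)}"
  have W: "W \<subseteq> Pow V" "{} \<in> W" "V \<notin> W" unfolding W_def using no_path \<Gamma> F_empty by auto
  have fW: "finite W" using W(1) finV finite_subset by auto
  have edge: "exp (- \<beta> * F A) * kernel \<beta> A B \<le> exp (- \<beta> * \<Gamma>)" if A: "A \<in> W" and B: "B \<in> Pow V - W" for A B
  proof (cases "\<exists>v\<in>V. B = toggle v A")
    case True
    obtain \<gamma> where \<gamma>: "\<gamma> < \<Gamma>" "0 \<le> \<gamma>" "F A \<le> \<gamma>" "(step \<gamma>)\<^sup>*\<^sup>* {} A" using A unfolding W_def by auto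
    have "F B \<ge> \<Gamma>"
    proof (rule ccontr)
      assume FB: "\<not> F B \<ge> \<Gamma>"
      have "step (max \<gamma> (F B)) A B"
        using True A B W(1) \<gamma>(3) unfolding step_def toggle_def by (auto split: if_splits)
      moreover have "(step (max \<gamma> (F B)))\<^sup>*\<^sup>* {} A" using step_mono[OF _ \<gamma>(4)] by simp
      ultimately have "(step (max \<gamma> (F B)))\<^sup>*\<^sup>* {} B" by simp
      then have "B \<in> W" unfolding W_def using FB \<gamma>(1,2) B
        by (auto intro!: exI[of _ "max \<gamma> (F B)"])
      then show False using B by simp
    qed
    have "exp (- \<beta> * F A) * kernel \<beta> A B = exp (- \<beta> * F B) * kernel \<beta> B A"
      using A B W(1) by (intro reversible) auto
    also have "\<dots> \<le> exp (- \<beta> * F B) * 1"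
      using A B W(1) P_row_le_1[of B "{A}"] by (intro mult_left_mono) auto
    also have "\<dots> \<le> exp (- \<beta> * \<Gamma>)" using \<open>F B \<ge> \<Gamma>\<close> \<beta> by simp
    finally show ?thesis .
  next
    case False
    then show ?thesis using A B unfolding kernel_def off_def by auto
  qed
  have "(\<Sum>x\<in>W. \<Sum>y\<in>Pow V - W. exp (- \<beta> * F x) * kernel \<beta> x y) \<le> (\<Sum>x\<in>W. \<Sum>y\<in>Pow V - W. exp (- \<beta> * \<Gamma>))"
    by (intro sum_mono edge)
  also have "\<dots> = real (card W) * real (card (Pow V - W)) * exp (- \<beta> * \<Gamma>)" by simp
  also have "\<dots> \<le> real (card (Pow V)) * real (card (Pow V)) * exp (- \<beta> * \<Gamma>)"
    using finV W(1) by (intro mult_right_mono mult_mono) (auto intro!: card_mono simp del: card_Pow simp: of_nat_le_iff)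
  finally have Q: "(\<Sum>x\<in>W. \<Sum>y\<in>Pow V - W. exp (- \<beta> * F x) * kernel \<beta> x y) \<le> real (card (Pow V)) ^ 2 * exp (- \<beta> * \<Gamma>)"
    by (simp add: power2_eq_square)
  have "1 - surv {V} n {} \<le> 1 - surv (Pow V - W) n {}"
    using surv_target_mono[of "{}" "{V}" "Pow V - W" n] W by simp
  also have "\<dots> \<le> real n * (\<Sum>x\<in>W. \<Sum>y\<in>Pow V - W. exp (- \<beta> * F x) * kernel \<beta> x y)"
    using surv_valley[OF W(1,2), of n] by (simp add: F_empty)
  also have "\<dots> \<le> real n * (real (card (Pow V)) ^ 2 * exp (- \<beta> * \<Gamma>))" using Q by (intro mult_left_mono) auto
  finally show ?thesis .
qed

theorem metastable_exit:
  defines "u \<equiv> \<lambda>\<beta> n. survival \<beta> {V} n {}"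
  defines "T \<equiv> \<lambda>\<beta>. LEAST n. n \<ge> 1 \<and> u \<beta> n \<le> exp (-1)"
  shows "t > 0 \<Longrightarrow> ((\<lambda>\<beta>. u \<beta> (nat \<lfloor>t * real (T \<beta>)\<rfloor>)) \<longlongrightarrow> exp (- t)) at_top"
    and "((\<lambda>\<beta>. suminf (u \<beta>) / real (T \<beta>)) \<longlongrightarrow> 1) at_top"
proof -
  obtain \<Gamma> \<delta> where \<delta>: "0 < \<delta>" "\<delta> \<le> \<Gamma>"
    and no_path: "\<And>\<gamma>. \<gamma> < \<Gamma> \<Longrightarrow> 0 \<le> \<gamma> \<Longrightarrow> \<not> (step \<gamma>)\<^sup>*\<^sup>* {} V"
    and relax: "\<And>\<eta>. \<eta> \<subseteq> V \<Longrightarrow> \<exists>\<zeta>\<in>{{}, V}. (step (F \<eta> + \<Gamma> - \<delta>))\<^sup>*\<^sup>* \<eta> \<zeta>"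
    by (rule metastable_landscape) (rule that)
  have \<Gamma>: "\<Gamma> > 0" using \<delta> by simp
  have "\<exists>K M. K > 0 \<and> (\<forall>\<beta> n. \<forall>\<eta>\<in>Pow V - {V, {}}. \<beta> > 0 \<longrightarrow>
    survival \<beta> {V, {}} n \<eta> \<le> exp (\<beta> * M + K - exp (- \<beta> * (\<Gamma> - \<delta>)) / K * real n))"
  proof (rule survival_decay)
    show "\<exists>\<zeta>\<in>{V, {}}. (step (F \<eta> + (\<Gamma> - \<delta>)))\<^sup>*\<^sup>* \<eta> \<zeta>" if "\<eta> \<in> Pow V - {V, {}}" for \<eta>
      using relax[of \<eta>] that by (auto simp: add_diff_eq)
  qed auto
  then obtain K M where K: "K > 0" and "\<forall>\<beta> n. \<forall>\<eta>\<in>Pow V - {V, {}}. \<beta> > 0 \<longrightarrow>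
    survival \<beta> {V, {}} n \<eta> \<le> exp (\<beta> * M + K - exp (- \<beta> * (\<Gamma> - \<delta>)) / K * real n)"
    by (elim exE conjE)
  note decay = this(2)[rule_format]
  obtain B where B: "B \<ge> 0" "\<And>A. A \<subseteq> V \<Longrightarrow> \<bar>F A\<bar> \<le> B" using F_bounded by blast
  \<comment> \<open>A far slower decay towards \<open>V\<close> alone, along paths with the crude
    climb \<open>2 * B\<close>; it yields finiteness of the mean for each fixed \<beta>.\<close>
  have "\<exists>K M. K > 0 \<and> (\<forall>\<beta> n. \<forall>\<eta>\<in>Pow V - {V}. \<beta> > 0 \<longrightarrow>
    survival \<beta> {V} n \<eta> \<le> exp (\<beta> * M + K - exp (- \<beta> * (2 * B)) / K * real n))"
  proof (rule survival_decay)
    show "\<exists>\<zeta>\<in>{V}. (step (F \<eta> + 2 * B))\<^sup>*\<^sup>* \<eta> \<zeta>" if \<eta>: "\<eta> \<in> Pow V - {V}" for \<eta>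
    proof -
      have "F A \<le> F \<eta> + 2 * B" if "A \<subseteq> V" for A
        using B(2)[OF that] B(2)[of \<eta>] \<eta> by auto
      then show ?thesis using step_to_full[of "F \<eta> + 2 * B" \<eta>] \<eta> by auto
    qed
  qed auto
  then obtain K' M' where K': "K' > 0" and "\<forall>\<beta> n. \<forall>\<eta>\<in>Pow V - {V}. \<beta> > 0 \<longrightarrow>
    survival \<beta> {V} n \<eta> \<le> exp (\<beta> * M' + K' - exp (- \<beta> * (2 * B)) / K' * real n)"
    by (elim exE conjE)
  note decay' = this(2)[rule_format]
  \<comment> \<open>Halfway between the two exponents: the decay rate times \<open>R\<close> is at
    least \<open>exp (\<beta> * (\<delta> / 2)) / K\<close>, while \<open>R * q\<close> is at most
    of order \<open>exp (- \<beta> * (\<delta> / 2))\<close>.\<close>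
  define R where "R \<beta> = nat \<lceil>exp (\<beta> * (\<Gamma> - \<delta> / 2))\<rceil>" for \<beta> :: real
  define \<epsilon> where "\<epsilon> \<beta> = exp (\<beta> * M + K - exp (\<beta> * (\<delta> / 2)) / K)" for \<beta> :: real
  define C where "C = real (card (Pow V)) ^ 2"
  define q where "q \<beta> = C * exp (- \<beta> * \<Gamma>)" for \<beta> :: real
  have Rge: "exp (\<beta> * (\<Gamma> - \<delta> / 2)) \<le> real (R \<beta>)" and Rle: "real (R \<beta>) \<le> exp (\<beta> * (\<Gamma> - \<delta> / 2)) + 1" for \<beta>
    unfolding R_def by (auto simp: of_nat_nat less_imp_le)
  have eps: "survival \<beta> {V, {}} (R \<beta>) \<eta> \<le> \<epsilon> \<beta>" if "\<beta> > 0" "\<eta> \<in> Pow V - {V, {}}" for \<beta> \<eta>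
  proof -
    have "exp (\<beta> * (\<delta> / 2)) / K = exp (- \<beta> * (\<Gamma> - \<delta>)) / K * exp (\<beta> * (\<Gamma> - \<delta> / 2))"
      by (simp add: exp_add[symmetric] algebra_simps)
    also have "\<dots> \<le> exp (- \<beta> * (\<Gamma> - \<delta>)) / K * real (R \<beta>)" using Rge K by (intro mult_left_mono) auto
    finally have "exp (\<beta> * M + K - exp (- \<beta> * (\<Gamma> - \<delta>)) / K * real (R \<beta>)) \<le> \<epsilon> \<beta>" unfolding \<epsilon>_def by simp
    then show ?thesis using decay[OF that(2,1), of "R \<beta>"] by linarith
  qed
  have summ: "summable (u \<beta>)" if \<beta>: "\<beta> > 0" for \<beta>
  proof (rule summable_comparison_test)
    interpret reversible_chain "Pow V" "kernel \<beta>" "\<lambda>A. exp (- \<beta> * F A)"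
      by (rule reversible_metropolis[OF \<beta>])
    define k where "k = exp (- \<beta> * (2 * B)) / K'"
    have k: "k > 0" unfolding k_def using K' by simp
    have "norm (u \<beta> n) \<le> exp (\<beta> * M' + K') * exp (- k) ^ n" for n
    proof -
      have "survival \<beta> {V} n {} \<le> exp (\<beta> * M' + K' - k * real n)"
        using decay'[OF _ \<beta>, of "{}" n] V_ne unfolding k_def by auto
      also have "\<dots> = exp (\<beta> * M' + K') * exp (- k) ^ n"
        unfolding exp_of_nat_mult[symmetric] exp_add[symmetric] by (simp add: algebra_simps)
      finally show ?thesis unfolding u_def using surv_nonneg[of "{}" "{V}" n] by simp
    qed
    then show "\<exists>N. \<forall>n\<ge>N. norm (u \<beta> n) \<le> exp (\<beta> * M' + K') * exp (- k) ^ n" by blast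
    show "summable (\<lambda>n. exp (\<beta> * M' + K') * exp (- k) ^ n)"
      using k by (intro summable_mult summable_geometric) simp
  qed
  interpret almost_memoryless u R \<epsilon> q
  proof
    show "(\<epsilon> \<longlongrightarrow> 0) at_top" unfolding \<epsilon>_def using \<delta>(1) K by real_asymp
    show "((\<lambda>\<beta>. real (R \<beta>) * q \<beta>) \<longlongrightarrow> 0) at_top"
    proof (rule tendsto_sandwich[OF _ _ tendsto_const])
      show "\<forall>\<^sub>F \<beta> in at_top. 0 \<le> real (R \<beta>) * q \<beta>" unfolding q_def C_def by simp
      have "real (R \<beta>) * q \<beta> \<le> C * (exp (- \<beta> * (\<delta> / 2)) + exp (- \<beta> * \<Gamma>))" for \<beta>
      proof -
        have "real (R \<beta>) * q \<beta> \<le> (exp (\<beta> * (\<Gamma> - \<delta> / 2)) + 1) * (C * exp (- \<beta> * \<Gamma>))"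
          unfolding q_def C_def by (intro mult_right_mono Rle) auto
        also have "\<dots> = C * (exp (- \<beta> * (\<delta> / 2)) + exp (- \<beta> * \<Gamma>))"
          by (simp add: algebra_simps exp_add[symmetric])
        finally show ?thesis .
      qed
      then show "\<forall>\<^sub>F \<beta> in at_top. real (R \<beta>) * q \<beta> \<le> C * (exp (- \<beta> * (\<delta> / 2)) + exp (- \<beta> * \<Gamma>))" by simp
      have lim: "((\<lambda>\<beta>. exp (- \<beta> * c)) \<longlongrightarrow> 0) at_top" if "c > 0" for c :: real
        using that by real_asymp
      show "((\<lambda>\<beta>. C * (exp (- \<beta> * (\<delta> / 2)) + exp (- \<beta> * \<Gamma>))) \<longlongrightarrow> 0) at_top"
        using tendsto_mult[OF tendsto_const[of C] tendsto_add[OF lim[of "\<delta> / 2"] lim[OF \<Gamma>]]] \<delta>(1) by simp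
    qed
    fix \<beta> :: real assume \<beta>: "\<beta> > 0"
    interpret reversible_chain "Pow V" "kernel \<beta>" "\<lambda>A. exp (- \<beta> * F A)"
      by (rule reversible_metropolis[OF \<beta>])
    have VS: "V \<in> Pow V" "{} \<in> Pow V" "{} \<noteq> V" using V_ne by auto
    show e0: "0 \<le> \<epsilon> \<beta>" unfolding \<epsilon>_def by simp
    have "0 < real (R \<beta>)" using Rge[of \<beta>] by (smt (verit) exp_gt_zero)
    then show "1 \<le> R \<beta>" by simp
    show "u \<beta> 0 = 1" unfolding u_def by simp
    show "summable (u \<beta>)" by (rule summ[OF \<beta>])
    fix n
    show "0 \<le> u \<beta> n" unfolding u_def using VS by (intro surv_nonneg)
    show "u \<beta> (Suc n) \<le> u \<beta> n" unfolding u_def using VS by (intro surv_Suc_le)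
    show "1 - u \<beta> n \<le> real n * q \<beta>"
      unfolding u_def q_def C_def using escape_slow[OF \<Gamma> no_path \<beta>] .
    fix k
    show "u \<beta> (n + R \<beta> + k) \<le> u \<beta> n * (u \<beta> k + \<epsilon> \<beta>)"
      unfolding u_def by (rule surv_renewal_upper[OF VS e0 eps[OF \<beta>]])
    show "(u \<beta> (n + R \<beta>) - \<epsilon> \<beta> * u \<beta> n) * u \<beta> k \<le> u \<beta> (n + k)"
      unfolding u_def by (rule surv_renewal_lower[OF VS e0 eps[OF \<beta>]])
  qed
  have T: "T = almost_memoryless.T u" unfolding assms(2) T_def ..
  show "t > 0 \<Longrightarrow> ((\<lambda>\<beta>. u \<beta> (nat \<lfloor>t * real (T \<beta>)\<rfloor>)) \<longlongrightarrow> exp (- t)) at_top"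
    unfolding T by (rule exponential_limit)
  show "((\<lambda>\<beta>. suminf (u \<beta>) / real (T \<beta>)) \<longlongrightarrow> 1) at_top"
    unfolding T by (rule mean_limit)
qed

end

section \<open>The hexagonal torus\<close>

lemma finite_sites: "finite (sites L)"
proof -
  have "sites L = {..<L} \<times> {..<L} \<times> UNIV" by (auto simp: sites_def)
  then show ?thesis by simp
qed

lemma adj_sites: "adj L x y \<Longrightarrow> x \<in> sites L \<and> y \<in> sites L"
  by (simp add: adj_def)

lemma adj_orientation: "adj L x y \<Longrightarrow> snd (snd x) \<noteq> snd (snd y)"
  by (cases x; cases y) (auto simp: adj_def split: bool.splits)

lemma adj_sym: "adj L x y \<longleftrightarrow> adj L y x"
  by (cases x; cases y) (auto simp: adj_def split: bool.splits)

text \<open>Integer coordinates modulo \<open>L\<close> allow negative displacements;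
  \<open>pt_eq_iff\<close> turns equality of sites into divisibility.\<close>

definition pt :: "nat \<Rightarrow> int \<Rightarrow> int \<Rightarrow> bool \<Rightarrow> site" where
  "pt L i j s = (nat (i mod int L), nat (j mod int L), s)"

locale hex_torus =
  fixes L :: nat and J h :: real
  assumes L_pos: "L \<ge> 1" and h_pos: "0 < h" and h_less_J: "h < J"
begin

abbreviation "S \<equiv> sites L"

lemma pt_in_sites: "pt L i j s \<in> S"
  using L_pos by (simp add: pt_def sites_def nat_less_iff)

lemma site_eq_pt: "(a, b, s) \<in> S \<Longrightarrow> (a, b, s) = pt L (int a) (int b) s"
  by (simp add: pt_def sites_def)

lemma site_cases: assumes "x \<in> S" obtains i j s where "x = pt L i j s"
  using assms site_eq_pt by (cases x) metis

lemma pt_eq_iff: "pt L i j s = pt L k l t \<longleftrightarrow> int L dvd i - k \<and> int L dvd j - l \<and> s = t"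
  using L_pos by (auto simp: pt_def eq_nat_nat_iff mod_eq_dvd_iff)

lemma pred_mod: "(nat (i mod int L) + L - 1) mod L = nat ((i - 1) mod int L)"
proof -
  have "int ((nat (i mod int L) + L - 1) mod L) = (i mod int L + int L - 1) mod int L"
    using L_pos by (simp add: zmod_int of_nat_diff)
  also have "\<dots> = (i mod int L - 1 + int L) mod int L" by (simp add: algebra_simps)
  also have "\<dots> = (i - 1) mod int L" by (simp add: mod_simps)
  finally show ?thesis by linarith
qed

text \<open>The displacements \<open>(0, 0)\<close>, \<open>(-1, 0)\<close> and
  \<open>(0, -1)\<close> modulo \<open>L\<close> from an up-triangle to its neighbours.\<close>

definition near :: "int \<Rightarrow> int \<Rightarrow> bool" where
  "near p q \<longleftrightarrow> int L dvd p \<and> int L dvd q \<or> int L dvd p + 1 \<and> int L dvd q \<or> int L dvd p \<and> int L dvd q + 1"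

lemma adj_up_down: "adj L (pt L i j True) (pt L k l False) \<longleftrightarrow> near (k - i) (l - j)"
proof -
  have "adj L (pt L i j True) (pt L k l False) \<longleftrightarrow>
      pt L k l False = pt L i j False \<or> pt L k l False = pt L (i - 1) j False \<or> pt L k l False = pt L i (j - 1) False"
    unfolding adj_def using pt_in_sites[of i j True] pt_in_sites[of k l False]
    by (simp add: pt_def up_down_adj_def pred_mod[unfolded One_nat_def])
  then show ?thesis unfolding pt_eq_iff near_def by (simp add: algebra_simps)
qed

lemma adj_pt: "adj L (pt L i j s) (pt L k l t) \<longleftrightarrow>
    s \<noteq> t \<and> (if s then near (k - i) (l - j) else near (i - k) (j - l))"
proof (cases "s = t")
  case True
  then show ?thesis using adj_orientation[of L "pt L i j s" "pt L k l t"] by (auto simp: pt_def)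
next
  case False
  then show ?thesis using adj_up_down adj_sym[of L "pt L i j s" "pt L k l t"] by (cases s; cases t) auto
qed

section \<open>Automorphisms and arc-transitivity\<close>

definition automorphism :: "(site \<Rightarrow> site) \<Rightarrow> bool" where
  "automorphism g \<longleftrightarrow> bij_betw g S S \<and> (\<forall>x\<in>S. \<forall>y\<in>S. adj L (g x) (g y) = adj L x y)"

lemma automorphismI:
  assumes "\<And>x. x \<in> S \<Longrightarrow> g x \<in> S" "inj_on g S" "\<And>x y. x \<in> S \<Longrightarrow> y \<in> S \<Longrightarrow> adj L (g x) (g y) = adj L x y"
  shows "automorphism g"
  unfolding automorphism_def bij_betw_def using assms finite_sites[of L]
  by (auto intro!: endo_inj_surj[THEN equalityD2, THEN subsetD])

lemma automorphism_comp: "automorphism f \<Longrightarrow> automorphism g \<Longrightarrow> automorphism (g \<circ> f)"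
  unfolding automorphism_def by (auto intro: bij_betw_trans simp: bij_betw_apply)

lemma automorphism_inv: assumes "automorphism g" shows "automorphism (inv_into S g)"
proof -
  have g: "bij_betw g S S" using assms unfolding automorphism_def by simp
  have b: "bij_betw (inv_into S g) S S" using bij_betw_inv_into[OF g] .
  moreover have "adj L (inv_into S g x) (inv_into S g y) = adj L x y" if "x \<in> S" "y \<in> S" for x y
  proof -
    have "adj L (g (inv_into S g x)) (g (inv_into S g y)) = adj L (inv_into S g x) (inv_into S g y)"
      using assms that b unfolding automorphism_def by (auto simp: bij_betw_apply)
    then show ?thesis using that g by (simp add: bij_betw_inv_into_right)
  qed
  ultimately show ?thesis unfolding automorphism_def by blast
qed

definition translate :: "int \<Rightarrow> int \<Rightarrow> site \<Rightarrow> site" where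
  "translate c d = (\<lambda>(a, b, s). pt L (int a + c) (int b + d) s)"

text \<open>Rotation by 120 degrees about the centre of the up-triangle at the origin.\<close>
definition rotate3 :: "site \<Rightarrow> site" where
  "rotate3 = (\<lambda>(a, b, s). pt L (- int a - int b - (if s then 0 else 1)) (int a) s)"

text \<open>The half-turn about the midpoint of the edge shared by the two triangles at the
  origin.\<close>

definition reflect :: "site \<Rightarrow> site" where
  "reflect = (\<lambda>(a, b, s). pt L (- int a) (- int b) (\<not> s))"

lemma pt_cong: "int L dvd i - k \<Longrightarrow> int L dvd j - l \<Longrightarrow> pt L i j s = pt L k l s"
  by (simp add: pt_eq_iff)

lemma mod_dvd: "int L dvd i mod int L - i" "int L dvd i - i mod int L"
  by (simp_all add: mod_eq_dvd_iff[symmetric])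

lemma translate_pt: "translate c d (pt L i j s) = pt L (i + c) (j + d) s"
proof -
  have "translate c d (pt L i j s) = pt L (i mod int L + c) (j mod int L + d) s"
    using L_pos unfolding translate_def pt_def[of L i j s] by simp
  also have "\<dots> = pt L (i + c) (j + d) s" by (rule pt_cong) (simp_all add: mod_dvd)
  finally show ?thesis .
qed

lemma rotate3_pt: "rotate3 (pt L i j s) = pt L (- i - j - (if s then 0 else 1)) i s"
proof -
  have "rotate3 (pt L i j s) = pt L (- (i mod int L) - j mod int L - (if s then 0 else 1)) (i mod int L) s"
    using L_pos unfolding rotate3_def pt_def[of L i j s] by simp
  also have "\<dots> = pt L (- i - j - (if s then 0 else 1)) i s"
  proof (rule pt_cong)
    have "int L dvd (i - i mod int L) + (j - j mod int L)" by (intro dvd_add mod_dvd)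
    then show "int L dvd - (i mod int L) - j mod int L - (if s then 0 else 1) - (- i - j - (if s then 0 else 1))"
      by (simp add: algebra_simps)
  qed (simp add: mod_dvd)
  finally show ?thesis .
qed

lemma reflect_pt: "reflect (pt L i j s) = pt L (- i) (- j) (\<not> s)"
proof -
  have "reflect (pt L i j s) = pt L (- (i mod int L)) (- (j mod int L)) (\<not> s)"
    using L_pos unfolding reflect_def pt_def[of L i j s] by simp
  also have "\<dots> = pt L (- i) (- j) (\<not> s)" by (rule pt_cong) (simp_all add: mod_dvd)
  finally show ?thesis .
qed

lemma automorphism_pt:
  assumes "\<And>i j s. g (pt L i j s) \<in> S"
    and "\<And>i j s k l t. g (pt L i j s) = g (pt L k l t) \<Longrightarrow> pt L i j s = pt L k l t"
    and "\<And>i j k l. adj L (g (pt L i j True)) (g (pt L k l False)) = adj L (pt L i j True) (pt L k l False)"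
    and "\<And>i j s k l. \<not> adj L (g (pt L i j s)) (g (pt L k l s))"
  shows "automorphism g"
proof (rule automorphismI)
  show "g x \<in> S" if "x \<in> S" for x using assms(1) that by (metis site_cases)
  show "inj_on g S" by (rule inj_onI) (metis assms(2) site_cases)
  fix x y assume "x \<in> S" "y \<in> S"
  then obtain i j s k l t where xy: "x = pt L i j s" "y = pt L k l t" by (metis site_cases)
  show "adj L (g x) (g y) = adj L x y"
  proof (cases "s = t")
    case True then show ?thesis using assms(4) xy by (simp add: adj_pt)
  next
    case False
    then show ?thesis
      using assms(3)[of i j k l] assms(3)[of k l i j] adj_sym[of L "g x" "g y"] adj_sym[of L x y] xy
      by (cases s; cases t) auto
  qed
qed

lemma automorphism_translate: "automorphism (translate c d)"
  by (rule automorphism_pt) (auto simp: translate_pt pt_in_sites pt_eq_iff adj_pt)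

lemma automorphism_reflect: "automorphism reflect"
proof (rule automorphism_pt)
  fix i j s k l t assume "reflect (pt L i j s) = reflect (pt L k l t)"
  then show "pt L i j s = pt L k l t"
    unfolding reflect_pt pt_eq_iff using dvd_diff_commute[of "int L"] by simp
qed (auto simp: reflect_pt pt_in_sites adj_pt)

lemma automorphism_rotate3: "automorphism rotate3"
proof (rule automorphism_pt)
  fix i j s k l t assume "rotate3 (pt L i j s) = rotate3 (pt L k l t)"
  then have *: "int L dvd - i - j - (if s then 0 else 1) - (- k - l - (if t then 0 else 1))" "int L dvd i - k" "s = t"
    unfolding rotate3_pt pt_eq_iff by blast+
  have "int L dvd (- i - j - (if s then 0 else 1) - (- k - l - (if t then 0 else 1))) + (i - k)"
    using * by (intro dvd_add)
  also have "\<dots> = l - j" using *(3) by simp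
  finally have "int L dvd l - j" .
  then show "pt L i j s = pt L k l t" using * unfolding pt_eq_iff by (simp add: dvd_diff_commute)
next
  fix i j k l :: int
  have d1: "int L dvd - p - q - 1 \<longleftrightarrow> int L dvd q + 1" if "int L dvd p" for p q
  proof -
    have "- p - q - 1 = - (p + (q + 1))" by simp
    then show ?thesis using dvd_add_right_iff[OF that, of "q + 1"] by (metis dvd_minus_iff)
  qed
  have d2: "int L dvd - p - q \<longleftrightarrow> int L dvd q" if "int L dvd p" for p q
  proof -
    have "- p - q = - (p + q)" by simp
    then show ?thesis using dvd_add_right_iff[OF that, of q] by (metis dvd_minus_iff)
  qed
  have d3: "int L dvd - p - q - 1 \<longleftrightarrow> int L dvd q" if "int L dvd p + 1" for p q
  proof -
    have "- p - q - 1 = - ((p + 1) + q)" by simp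
    then show ?thesis using dvd_add_right_iff[OF that, of q] by (metis dvd_minus_iff)
  qed
  \<comment> \<open>The rotation permutes the displacements cyclically: \<open>(0, 0)\<close> to
    \<open>(-1, 0)\<close> to \<open>(0, -1)\<close> and back to \<open>(0, 0)\<close>.\<close>
  have near_rot: "near (- p - q - 1) p \<longleftrightarrow> near p q" for p q
    unfolding near_def using d1[of p q] d2[of p q] d3[of p q] by auto
  have "- k - l - 1 - (- i - j) = - (k - i) - (l - j) - 1" by simp
  then have "near (- k - l - 1 - (- i - j)) (k - i) \<longleftrightarrow> near (k - i) (l - j)"
    by (simp only: near_rot)
  then show "adj L (rotate3 (pt L i j True)) (rotate3 (pt L k l False)) = adj L (pt L i j True) (pt L k l False)"
    by (simp add: rotate3_pt adj_pt)
qed (auto simp: rotate3_pt pt_in_sites adj_pt)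

text \<open>Translate the up-triangle to the origin; at most two rotations about it bring the
  neighbour into standard position.\<close>

lemma standard_arc_up:
  assumes "adj L (pt L i j True) (pt L k l False)"
  shows "\<exists>g. automorphism g \<and> g (pt L i j True) = pt L 0 0 True \<and> g (pt L k l False) = pt L 0 0 False"
proof -
  let ?t = "translate (- i) (- j)"
  have t: "automorphism ?t" "?t (pt L i j True) = pt L 0 0 True" "?t (pt L k l False) = pt L (k - i) (l - j) False"
    by (simp_all add: automorphism_translate translate_pt)
  have r: "rotate3 (pt L 0 0 True) = pt L 0 0 True" "rotate3 (pt L (- 1) 0 False) = pt L 0 (- 1) False"
    "rotate3 (pt L 0 (- 1) False) = pt L 0 0 False" by (simp_all add: rotate3_pt)
  have "near (k - i) (l - j)" using assms by (simp add: adj_pt)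
  then consider "pt L (k - i) (l - j) False = pt L 0 0 False" | "pt L (k - i) (l - j) False = pt L (- 1) 0 False"
    | "pt L (k - i) (l - j) False = pt L 0 (- 1) False"
    unfolding near_def pt_eq_iff by auto
  then show ?thesis
  proof cases
    case 1 then show ?thesis using t by (intro exI[of _ ?t]) simp
  next
    case 2
    have "automorphism (rotate3 \<circ> (rotate3 \<circ> ?t))" by (intro automorphism_comp t automorphism_rotate3)
    then show ?thesis using 2 t r by (intro exI[of _ "rotate3 \<circ> (rotate3 \<circ> ?t)"]) simp
  next
    case 3
    have "automorphism (rotate3 \<circ> ?t)" by (intro automorphism_comp t automorphism_rotate3)
    then show ?thesis using 3 t r by (intro exI[of _ "rotate3 \<circ> ?t"]) simp
  qed
qed

lemma standard_arc:
  assumes "adj L x y"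
  shows "\<exists>g. automorphism g \<and> g x = pt L 0 0 True \<and> g y = pt L 0 0 False"
proof -
  obtain i j s k l t where xy: "x = pt L i j s" "y = pt L k l t" using adj_sites[OF assms] by (metis site_cases)
  show ?thesis
  proof (cases s)
    case True
    then have "\<not> t" using assms xy by (simp add: adj_pt)
    then show ?thesis using standard_arc_up assms xy True by simp
  next
    case False
    then have t using assms xy by (simp add: adj_pt)
    have "adj L (reflect x) (reflect y)"
      using assms adj_sites[OF assms] automorphism_reflect unfolding automorphism_def by simp
    then obtain g where g: "automorphism g" "g (reflect x) = pt L 0 0 True" "g (reflect y) = pt L 0 0 False"
      using standard_arc_up[of "- i" "- j" "- k" "- l"] xy False \<open>t\<close> by (auto simp: reflect_pt)
    have "automorphism (g \<circ> reflect)" by (intro automorphism_comp g automorphism_reflect)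
    then show ?thesis using g by (intro exI[of _ "g \<circ> reflect"]) simp
  qed
qed

lemma arc_transitive:
  assumes "adj L x y" "adj L x' y'"
  shows "\<exists>g. automorphism g \<and> g x = x' \<and> g y = y'"
proof -
  obtain f where f: "automorphism f" "f x = pt L 0 0 True" "f y = pt L 0 0 False" using standard_arc[OF assms(1)] by blast
  obtain g where g: "automorphism g" "g x' = pt L 0 0 True" "g y' = pt L 0 0 False" using standard_arc[OF assms(2)] by blast
  have "inj_on g S" using g(1) unfolding automorphism_def bij_betw_def by simp
  then have "inv_into S g (f x) = x'" "inv_into S g (f y) = y'"
    using adj_sites[OF assms(2)] f g by (metis inv_into_f_f)+
  moreover have "automorphism (inv_into S g \<circ> f)" by (intro automorphism_comp automorphism_inv f g)
  ultimately show ?thesis by (intro exI[of _ "inv_into S g \<circ> f"]) simp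
qed

text \<open>A set closed under adjacency passes from an up-triangle through its down-triangle to the
  next up-triangle in either axis direction. By periodicity, nonnegative moves reach every
  site.\<close>

lemma connected_boundary:
  assumes A: "A \<subseteq> S" "A \<noteq> {}" "A \<noteq> S"
  shows "\<exists>x\<in>A. \<exists>y\<in>S - A. adj L x y"
proof (rule ccontr)
  assume "\<not> ?thesis"
  then have closed: "y \<in> A" if "x \<in> A" "adj L x y" for x y using that adj_sites by blast
  obtain i j s where "pt L i j s \<in> A" using A(1,2) by (metis ex_in_conv site_cases subsetD)
  moreover have "adj L (pt L i j False) (pt L i j True)" by (simp add: adj_pt near_def)
  ultimately have start: "pt L i j True \<in> A" using closed by (cases s) auto
  have down: "pt L i j False \<in> A" if "pt L i j True \<in> A" for i j
    using closed[OF that, of "pt L i j False"] by (simp add: adj_pt near_def)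
  have right: "pt L (i + 1) j True \<in> A" "pt L i (j + 1) True \<in> A" if "pt L i j True \<in> A" for i j
    using closed[OF down[OF that], of "pt L (i + 1) j True"] closed[OF down[OF that], of "pt L i (j + 1) True"]
    by (simp_all add: adj_pt near_def)
  have row: "pt L (i + int n) j True \<in> A" for n
    by (induction n) (use start right(1) in \<open>auto simp: add.assoc[symmetric] add.commute[of 1]\<close>)
  have all: "pt L (i + int n) (j + int m) True \<in> A" for n m
    by (induction m) (use row right(2) in \<open>auto simp: add.assoc[symmetric] add.commute[of 1]\<close>)
  have "x \<in> A" if xS: "x \<in> S" for x
  proof -
    obtain k l t where x: "x = pt L k l t" using site_cases[OF xS] .
    have "pt L (i + int (nat ((k - i) mod int L))) (j + int (nat ((l - j) mod int L))) True = pt L k l True"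
    proof (rule pt_cong)
      show "int L dvd i + int (nat ((k - i) mod int L)) - k"
        using L_pos mod_dvd(1)[of "k - i"] by (simp add: algebra_simps)
      show "int L dvd j + int (nat ((l - j) mod int L)) - l"
        using L_pos mod_dvd(1)[of "l - j"] by (simp add: algebra_simps)
    qed
    then have "pt L k l True \<in> A" using all by metis
    then show ?thesis using x down by (cases t) auto
  qed
  then show False using A by blast
qed

section \<open>Boundary length and energy\<close>

definition arcs :: "(site \<times> site) set" where
  "arcs = {(x, y). adj L x y}"

text \<open>Counting arcs directed out of \<open>A\<close> counts each boundary edge once and makes
  submodularity hold term by term.\<close>

definition cut :: "site set \<Rightarrow> real" where
  "cut A = (\<Sum>p\<in>arcs. if fst p \<in> A \<and> snd p \<notin> A then 1 else 0)"

definition excess :: "site set \<Rightarrow> real" where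
  "excess A = J * cut A - h * real (card A)"

lemma finite_arcs: "finite arcs"
proof (rule finite_subset)
  show "arcs \<subseteq> S \<times> S" using adj_sites by (auto simp: arcs_def)
qed (simp add: finite_sites)

lemma cut_submodular: "cut (A \<union> B) + cut (A \<inter> B) \<le> cut A + cut B"
  unfolding cut_def sum.distrib[symmetric] by (intro sum_mono) auto

lemma arcs_sites: "p \<in> arcs \<Longrightarrow> fst p \<in> S" "p \<in> arcs \<Longrightarrow> snd p \<in> S"
  using adj_sites[of L "fst p" "snd p"] by (auto simp: arcs_def)

lemma automorphism_arcs:
  assumes "automorphism f" shows "map_prod f f \<in> arcs \<rightarrow> arcs"
proof
  fix p assume "p \<in> arcs"
  then have "adj L (fst p) (snd p)" by (auto simp: arcs_def)
  then have "adj L (f (fst p)) (f (snd p))" using assms adj_sites unfolding automorphism_def by blast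
  then show "map_prod f f p \<in> arcs" by (simp add: arcs_def map_prod_def case_prod_beta)
qed

lemma arcs_orientation: "p \<in> arcs \<Longrightarrow> snd (snd (fst p)) \<noteq> snd (snd (snd p))"
  using adj_orientation[of L "fst p" "snd p"] by (auto simp: arcs_def)

lemma swap_in_arcs: "prod.swap p \<in> arcs \<longleftrightarrow> p \<in> arcs"
  using adj_sym[of L "fst p" "snd p"] by (cases p) (simp add: arcs_def)

lemma cut_image:
  assumes "automorphism g" "A \<subseteq> S" shows "cut (g ` A) = cut A"
proof -
  have g: "bij_betw g S S" "\<And>x y. x \<in> S \<Longrightarrow> y \<in> S \<Longrightarrow> adj L (g x) (g y) = adj L x y"
    using assms(1) unfolding automorphism_def by auto
  have inj: "inj_on g S" using g(1) by (simp add: bij_betw_def)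
  have mem: "g x \<in> g ` A \<longleftrightarrow> x \<in> A" if "x \<in> S" for x using inj assms(2) that by (simp add: inj_on_image_mem_iff)
  have "bij_betw (map_prod g g) arcs arcs"
  proof (rule bij_betwI[where g = "map_prod (inv_into S g) (inv_into S g)"])
    show "map_prod g g \<in> arcs \<rightarrow> arcs" "map_prod (inv_into S g) (inv_into S g) \<in> arcs \<rightarrow> arcs"
      by (intro automorphism_arcs assms automorphism_inv)+
  next
    fix p assume "p \<in> arcs"
    then have "fst p \<in> S" "snd p \<in> S" by (simp_all add: arcs_sites)
    then show "map_prod (inv_into S g) (inv_into S g) (map_prod g g p) = p"
      "map_prod g g (map_prod (inv_into S g) (inv_into S g) p) = p"
      using g(1) inj by (auto simp: map_prod_def case_prod_beta bij_betw_inv_into_right)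
  qed
  then have "cut (g ` A) = (\<Sum>p\<in>arcs. if fst (map_prod g g p) \<in> g ` A \<and> snd (map_prod g g p) \<notin> g ` A then 1 else 0)"
    unfolding cut_def by (rule sum.reindex_bij_betw[symmetric])
  also have "\<dots> = cut A"
    unfolding cut_def using mem by (intro sum.cong refl) (simp add: arcs_sites)
  finally show ?thesis .
qed

lemma ex_neighbour: assumes "x \<in> S" shows "\<exists>y. adj L x y"
proof -
  obtain i j s where "x = pt L i j s" using assms site_cases by blast
  then show ?thesis by (intro exI[of _ "pt L i j (\<not> s)"]) (auto simp: adj_pt near_def)
qed

text \<open>No arc leads from \<open>A\<close> to an isolated \<open>v\<close>, so deleting
  \<open>v\<close> creates no boundary arc, and at least the arc \<open>(v, y)\<close> is
  lost.\<close>

lemma cut_isolated: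
  assumes A: "A \<subseteq> S" "v \<in> A" "\<And>y. y \<in> A \<Longrightarrow> \<not> adj L v y"
  shows "cut (A - {v}) + 1 \<le> cut A"
proof -
  obtain y where y: "adj L v y" using ex_neighbour A by blast
  have "cut (A - {v}) + 1 = (\<Sum>p\<in>arcs. (if fst p \<in> A - {v} \<and> snd p \<notin> A - {v} then 1 else 0) + (if p = (v, y) then 1 else 0))"
    unfolding cut_def sum.distrib using finite_arcs y by (simp add: sum.delta arcs_def)
  also have "\<dots> \<le> cut A"
    unfolding cut_def
  proof (rule sum_mono)
    fix p assume "p \<in> arcs"
    then obtain a b where p: "p = (a, b)" "adj L a b" by (auto simp: arcs_def)
    have "b \<noteq> v \<or> a \<notin> A" using p A(3)[of a] adj_sym by blast
    then show "(if fst p \<in> A - {v} \<and> snd p \<notin> A - {v} then 1 else 0) + (if p = (v, y) then 1 else 0)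
      \<le> (if fst p \<in> A \<and> snd p \<notin> A then 1 else (0::real))"
      using A(2) A(3)[of y] y p(1) by auto
  qed
  finally show ?thesis .
qed

lemma J_pos: "J > 0" using h_pos h_less_J by simp

lemma excess_isolated:
  assumes A: "A \<subseteq> S" "v \<in> A" "\<And>y. y \<in> A \<Longrightarrow> \<not> adj L v y"
  shows "excess (A - {v}) + (J - h) \<le> excess A"
proof -
  have fA: "finite A" using A(1) finite_sites finite_subset by blast
  have "J * (cut (A - {v}) + 1) \<le> J * cut A" using cut_isolated[OF A] J_pos by (intro mult_left_mono) auto
  moreover have "real (card A) = real (card (A - {v})) + 1"
    using card_Suc_Diff1[OF fA A(2)] by linarith
  ultimately show ?thesis unfolding excess_def by (simp add: algebra_simps)
qed

lemma excess_empty: "excess {} = 0"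
  by (simp add: excess_def cut_def)

lemma not_adj_self: "\<not> adj L x x"
  using adj_orientation by blast

sublocale landscape S excess "adj L"
proof
  show "finite S" by (rule finite_sites)
  show "S \<noteq> {}" using pt_in_sites by blast
  show "excess {} = 0" by (rule excess_empty)
  show "excess (A \<union> B) + excess (A \<inter> B) \<le> excess A + excess B" if "A \<subseteq> S" "B \<subseteq> S" for A B
  proof -
    have "finite A" "finite B" using that finite_sites finite_subset by blast+
    then have "real (card (A \<union> B)) + real (card (A \<inter> B)) = real (card A) + real (card B)"
      using card_Un_Int[of A B] by linarith
    then have "h * real (card (A \<union> B)) + h * real (card (A \<inter> B)) = h * real (card A) + h * real (card B)"
      unfolding distrib_left[symmetric] by (rule arg_cong)
    moreover have "J * (cut (A \<union> B) + cut (A \<inter> B)) \<le> J * (cut A + cut B)"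
      using cut_submodular J_pos by (intro mult_left_mono) auto
    ultimately show ?thesis unfolding excess_def by (simp add: algebra_simps)
  qed
  show "excess {v} > 0" if "v \<in> S" for v
    using excess_isolated[of "{v}" v] that not_adj_self h_less_J by (simp add: excess_empty)
  show "excess S < 0"
  proof -
    have "cut S = 0" unfolding cut_def using adj_sites by (intro sum.neutral) (auto simp: arcs_def)
    moreover have "card S > 0" using finite_sites pt_in_sites by (auto simp: card_gt_0_iff)
    ultimately show ?thesis using h_pos unfolding excess_def by simp
  qed
  show "excess (A - {v}) \<le> excess A" if "A \<subseteq> S" "v \<in> A" "\<And>y. y \<in> A \<Longrightarrow> \<not> adj L v y" for A v
    using excess_isolated[OF that] h_less_J by simp
  show "\<exists>g. bij_betw g S S \<and> g x = x' \<and> g y = y' \<and> (\<forall>A\<subseteq>S. excess (g ` A) = excess A)"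
    if arcs: "adj L x y" "adj L x' y'" for x y x' y'
  proof -
    obtain g where g: "automorphism g" "g x = x'" "g y = y'" using arc_transitive[OF arcs] by blast
    have b: "bij_betw g S S" using g(1) by (simp add: automorphism_def)
    have "card (g ` A) = card A" if "A \<subseteq> S" for A
      using b that by (intro card_image) (auto simp: bij_betw_def inj_on_subset)
    then have "excess (g ` A) = excess A" if "A \<subseteq> S" for A
      using that cut_image[OF g(1)] unfolding excess_def by simp
    then show ?thesis using g b by blast
  qed
  show "\<exists>x\<in>A. \<exists>y\<in>S - A. adj L x y" if "A \<subseteq> S" "A \<noteq> {}" "A \<noteq> S" for A
    using connected_boundary[OF that] .
qed

section \<open>Configurations as sets of plus sites\<close>

definition conf :: "site set \<Rightarrow> site \<Rightarrow> int" where
  "conf A x = (if x \<in> S then if x \<in> A then 1 else - 1 else 0)"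

lemma conf_all_plus: "conf S = all_plus L"
  by (auto simp: conf_def all_plus_def)

lemma conf_all_minus: "conf {} = all_minus L"
  by (auto simp: conf_def all_minus_def)

lemma conf_inject: "A \<subseteq> S \<Longrightarrow> B \<subseteq> S \<Longrightarrow> conf A = conf B \<longleftrightarrow> A = B"
proof
  assume AB: "A \<subseteq> S" "B \<subseteq> S" and eq: "conf A = conf B"
  have "x \<in> A \<longleftrightarrow> x \<in> B" if "x \<in> S" for x
    using fun_cong[OF eq, of x] that by (auto simp: conf_def split: if_splits)
  then show "A = B" using AB by blast
qed simp

lemma bij_conf: "bij_betw conf (Pow S) (configs L)"
  unfolding bij_betw_def
proof
  show "inj_on conf (Pow S)" by (intro inj_onI) (simp add: conf_inject)
  show "conf ` Pow S = configs L"
  proof (intro equalityI subsetI)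
    fix \<sigma> assume "\<sigma> \<in> configs L"
    then have "\<sigma> x = conf {x \<in> S. \<sigma> x = 1} x" for x
      by (cases "x \<in> S") (auto simp: conf_def configs_def simp del: split_paired_All)
    then have "\<sigma> = conf {x \<in> S. \<sigma> x = 1}" by (rule ext)
    then show "\<sigma> \<in> conf ` Pow S" by blast
  qed (auto simp: conf_def configs_def)
qed

lemma flip_conf: "x \<in> S \<Longrightarrow> flip (conf A) x = conf (toggle x A)"
  by (auto simp: flip_def conf_def toggle_def)

text \<open>Every edge joins an up- and a down-triangle, so the arc starting at the up-triangle is a
  canonical representative.\<close>

lemma sum_nn_pairs:
  fixes f :: "site set \<Rightarrow> real"
  shows "(\<Sum>e\<in>nn_pairs L. f e) = (\<Sum>p\<in>{p \<in> arcs. snd (snd (fst p))}. f {fst p, snd p})"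
proof (rule sum.reindex_bij_betw[symmetric, where h = "\<lambda>p. {fst p, snd p}"])
  let ?E = "{p \<in> arcs. snd (snd (fst p))}"
  show "bij_betw (\<lambda>p. {fst p, snd p}) ?E (nn_pairs L)"
    unfolding bij_betw_def
  proof
    show "inj_on (\<lambda>p. {fst p, snd p}) ?E"
    proof (rule inj_onI)
      fix p p' assume "p \<in> ?E" "p' \<in> ?E" "{fst p, snd p} = {fst p', snd p'}"
      moreover from this have "\<not> snd (snd (snd p))" "\<not> snd (snd (snd p'))"
        using arcs_orientation by blast+
      ultimately have "fst p = fst p'" "snd p = snd p'" by (auto simp: doubleton_eq_iff)
      then show "p = p'" by (simp add: prod_eq_iff)
    qed
    show "(\<lambda>p. {fst p, snd p}) ` ?E = nn_pairs L"
    proof (intro equalityI subsetI)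
      fix e assume "e \<in> nn_pairs L"
      then obtain x y where xy: "e = {x, y}" "adj L x y" by (auto simp: nn_pairs_def)
      show "e \<in> (\<lambda>p. {fst p, snd p}) ` ?E"
      proof (cases "snd (snd x)")
        case True then show ?thesis using xy by (intro image_eqI[of _ _ "(x, y)"]) (auto simp: arcs_def)
      next
        case False
        then have "snd (snd y)" using adj_orientation[OF xy(2)] by simp
        then show ?thesis using xy adj_sym by (intro image_eqI[of _ _ "(y, x)"]) (auto simp: arcs_def)
      qed
    next
      fix e assume "e \<in> (\<lambda>p. {fst p, snd p}) ` ?E"
      then obtain p where "e = {fst p, snd p}" "adj L (fst p) (snd p)" by (auto simp: arcs_def)
      then show "e \<in> nn_pairs L" unfolding nn_pairs_def by blast
    qed
  qed
qed

lemma cut_unordered: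
  "cut A = (\<Sum>p\<in>{p \<in> arcs. snd (snd (fst p))}. if (fst p \<in> A) \<noteq> (snd p \<in> A) then 1 else 0)"
proof -
  let ?E = "{p \<in> arcs. snd (snd (fst p))}" and ?D = "{p \<in> arcs. \<not> snd (snd (fst p))}"
  let ?c = "\<lambda>p. if fst p \<in> A \<and> snd p \<notin> A then 1 else (0::real)"
  have "arcs = ?E \<union> ?D" by auto
  then have "cut A = sum ?c (?E \<union> ?D)" unfolding cut_def by simp
  also have "\<dots> = sum ?c ?E + sum ?c ?D" using finite_arcs by (intro sum.union_disjoint) auto
  also have "sum ?c ?D = (\<Sum>p\<in>?E. ?c (prod.swap p))"
  proof (rule sum.reindex_bij_betw[symmetric])
    show "bij_betw prod.swap ?E ?D"
    proof (rule bij_betwI[where g = prod.swap])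
      show "prod.swap \<in> ?E \<rightarrow> ?D"
      proof
        fix p assume "p \<in> ?E"
        then show "prod.swap p \<in> ?D" using arcs_orientation[of p] swap_in_arcs[of p] by simp
      qed
      show "prod.swap \<in> ?D \<rightarrow> ?E"
      proof
        fix p assume "p \<in> ?D"
        then show "prod.swap p \<in> ?E" using arcs_orientation[of p] swap_in_arcs[of p] by simp
      qed
    qed simp_all
  qed
  also have "sum ?c ?E + (\<Sum>p\<in>?E. ?c (prod.swap p)) = (\<Sum>p\<in>?E. ?c p + ?c (prod.swap p))"
    by (simp add: sum.distrib)
  also have "\<dots> = (\<Sum>p\<in>?E. if (fst p \<in> A) \<noteq> (snd p \<in> A) then 1 else 0)"
    by (intro sum.cong refl) auto
  finally show ?thesis .
qed

text \<open>An edge product is 1, or -1 across the boundary, and a plus spin changes the field sum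
  by 2; the factors one half in the Hamiltonian turn this into the costs \<open>J\<close> and
  \<open>- h\<close>.\<close>

lemma hamiltonian_conf:
  assumes "A \<subseteq> S" shows "hamiltonian L J h (conf A) = excess A + hamiltonian L J h (conf {})"
proof -
  let ?E = "{p \<in> arcs. snd (snd (fst p))}"
  have edge: "(\<Sum>e\<in>nn_pairs L. real_of_int (\<Prod>i\<in>e. conf B i)) = real (card ?E) - 2 * cut B" for B
  proof -
    have "(\<Sum>e\<in>nn_pairs L. real_of_int (\<Prod>i\<in>e. conf B i))
        = (\<Sum>p\<in>?E. 1 - 2 * (if (fst p \<in> B) \<noteq> (snd p \<in> B) then 1 else 0))"
      unfolding sum_nn_pairs
    proof (intro sum.cong refl)
      fix p assume "p \<in> ?E"
      then have "fst p \<in> S" "snd p \<in> S" "fst p \<noteq> snd p"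
        using arcs_sites[of p] arcs_orientation[of p] by auto
      then show "real_of_int (\<Prod>i\<in>{fst p, snd p}. conf B i) = 1 - 2 * (if (fst p \<in> B) \<noteq> (snd p \<in> B) then 1 else 0)"
        by (auto simp: conf_def)
    qed
    then show ?thesis unfolding cut_unordered by (simp add: sum_subtractf sum_distrib_left)
  qed
  have site: "(\<Sum>i\<in>S. real_of_int (conf B i)) = 2 * real (card B) - real (card S)" if "B \<subseteq> S" for B
  proof -
    have "(\<Sum>i\<in>S. real_of_int (conf B i)) = (\<Sum>i\<in>S. 2 * (if i \<in> B then 1 else 0) - 1)"
      by (intro sum.cong refl) (simp add: conf_def)
    also have "\<dots> = 2 * (\<Sum>i\<in>S. if i \<in> B then 1 else 0) - real (card S)"
      by (simp add: sum_subtractf sum_distrib_left)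
    also have "(\<Sum>i\<in>S. if i \<in> B then 1 else 0) = real (card B)"
      using that finite_sites by (simp add: sum.If_cases Int_absorb1)
    finally show ?thesis .
  qed
  show ?thesis unfolding hamiltonian_def edge site[OF assms] site[OF empty_subsetI] excess_def
    using excess_empty by (simp add: excess_def algebra_simps)
qed

lemma metro_off_conf:
  assumes "A \<subseteq> S" "B \<subseteq> S" shows "metro_off L J h \<beta> (conf A) (conf B) = off \<beta> A B"
proof -
  have "(\<exists>x\<in>S. conf B = flip (conf A) x) \<longleftrightarrow> (\<exists>x\<in>S. B = toggle x A)"
  proof (intro bex_cong refl)
    fix x assume x: "x \<in> S"
    then have "toggle x A \<subseteq> S" using assms(1) unfolding toggle_def by auto
    then show "conf B = flip (conf A) x \<longleftrightarrow> B = toggle x A"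
      using x assms(2) by (simp add: flip_conf conf_inject)
  qed
  then show ?thesis
    using assms unfolding metro_off_def off_def by (simp add: conf_inject hamiltonian_conf[OF assms(1)] hamiltonian_conf[OF assms(2)])
qed

lemma metro_conf:
  assumes "A \<subseteq> S" "B \<subseteq> S" shows "metro L J h \<beta> (conf A) (conf B) = kernel \<beta> A B"
proof -
  have "bij_betw conf (Pow S - {A}) (configs L - {conf A})"
    using bij_conf assms(1) by (intro bij_betw_DiffI) (auto simp: bij_betw_def)
  then have "(\<Sum>\<zeta>\<in>configs L - {conf A}. metro_off L J h \<beta> (conf A) \<zeta>)
      = (\<Sum>C\<in>Pow S - {A}. metro_off L J h \<beta> (conf A) (conf C))"
    by (rule sum.reindex_bij_betw[symmetric])
  also have "\<dots> = (\<Sum>C\<in>Pow S - {A}. off \<beta> A C)"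
    using assms by (intro sum.cong refl) (auto simp: metro_off_conf)
  finally show ?thesis using assms unfolding metro_def kernel_def by (simp add: conf_inject metro_off_conf)
qed

lemma hit_prob_conf:
  assumes \<beta>: "\<beta> > 0" and "A \<subseteq> S"
  shows "hit_prob L J h \<beta> {all_plus L} n (conf A) = 1 - survival \<beta> {S} n A"
proof -
  interpret reversible_chain "Pow S" "kernel \<beta>" "\<lambda>A. exp (- \<beta> * excess A)"
    by (rule reversible_metropolis[OF \<beta>])
  show ?thesis using assms(2)
  proof (induction n arbitrary: A)
    case (Suc n)
    have "hit_prob L J h \<beta> {all_plus L} (Suc n) (conf A)
      = (\<Sum>B\<in>Pow S. metro L J h \<beta> (conf A) (conf B) *
          (if conf B \<in> {all_plus L} then 1 else hit_prob L J h \<beta> {all_plus L} n (conf B)))"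
      unfolding hit_prob.simps by (rule sum.reindex_bij_betw[OF bij_conf, symmetric])
    also have "\<dots> = (\<Sum>B\<in>Pow S. kernel \<beta> A B - (if B = S then 0 else kernel \<beta> A B * surv {S} n B))"
      using Suc by (intro sum.cong refl)
        (simp add: metro_conf conf_all_plus[symmetric] conf_inject right_diff_distrib)
    also have "\<dots> = 1 - (\<Sum>B\<in>Pow S. if B = S then 0 else kernel \<beta> A B * surv {S} n B)"
      using P_row[of A] Suc.prems by (simp add: sum_subtractf)
    also have "(\<Sum>B\<in>Pow S. if B = S then 0 else kernel \<beta> A B * surv {S} n B) = surv {S} (Suc n) A"
      unfolding surv.simps using finite_sites by (intro sum.mono_neutral_cong_right) auto
    finally show ?case .
  qed simp
qed

end

theorem theorem2p7:
  fixes L :: nat and J h :: real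
  assumes "L \<ge> 1" and "0 < h" and "h < 1" and "J \<ge> 2 * h"
    and "J / (2 * h) - 1 / 2 \<notin> \<int>"
    and "real (card (sites L)) \<ge> (4 * J / h)\<^sup>2"
  shows "(\<forall>t > 0. ((\<lambda>\<beta>. 1 - hit_prob L J h \<beta> {all_plus L}
                            (nat \<lfloor>t * real (T_beta L J h \<beta>)\<rfloor>) (all_minus L))
                     \<longlongrightarrow> exp (- t)) at_top)
      \<and> ((\<lambda>\<beta>. expected_hit L J h \<beta> {all_plus L} (all_minus L) / real (T_beta L J h \<beta>))
                     \<longlongrightarrow> 1) at_top"
proof -
  interpret hex_torus L J h using assms by unfold_locales auto
  define u where "u \<beta> n = survival \<beta> {S} n {}" for \<beta> n
  define T where "T \<beta> = (LEAST n. n \<ge> 1 \<and> u \<beta> n \<le> exp (-1))" for \<beta>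
  have hit: "hit_prob L J h \<beta> {all_plus L} n (all_minus L) = 1 - u \<beta> n" if "\<beta> > 0" for \<beta> n
    unfolding u_def conf_all_minus[symmetric] by (rule hit_prob_conf[OF that]) simp
  have T: "T_beta L J h \<beta> = T \<beta>" if "\<beta> > 0" for \<beta>
  proof -
    have "1 - u \<beta> n \<ge> 1 - exp (-1) \<longleftrightarrow> u \<beta> n \<le> exp (-1)" for n by linarith
    then show ?thesis unfolding T_beta_def T_def hit[OF that] by simp
  qed
  have E: "expected_hit L J h \<beta> {all_plus L} (all_minus L) = suminf (u \<beta>)" if "\<beta> > 0" for \<beta>
    unfolding expected_hit_def hit[OF that] by simp
  \<comment> \<open>The identities \<open>hit\<close>, \<open>T\<close> and \<open>E\<close> are
    available for positive \<beta> only, which suffices for limits at infinity.\<close>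
  note pos = eventually_gt_at_top[of "0::real"]
  show ?thesis
  proof (intro conjI allI impI)
    fix t :: real assume "t > 0"
    then have "((\<lambda>\<beta>. u \<beta> (nat \<lfloor>t * real (T \<beta>)\<rfloor>)) \<longlongrightarrow> exp (- t)) at_top"
      using metastable_exit(1) unfolding u_def T_def by blast
    then show "((\<lambda>\<beta>. 1 - hit_prob L J h \<beta> {all_plus L}
        (nat \<lfloor>t * real (T_beta L J h \<beta>)\<rfloor>) (all_minus L)) \<longlongrightarrow> exp (- t)) at_top"
      by (rule tendsto_cong[THEN iffD1, rotated]) (use pos in eventually_elim, simp add: hit T)
  next
    have "((\<lambda>\<beta>. suminf (u \<beta>) / real (T \<beta>)) \<longlongrightarrow> 1) at_top"
      using metastable_exit(2) unfolding u_def T_def by (simp add: fun_eq_iff)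
    then show "((\<lambda>\<beta>. expected_hit L J h \<beta> {all_plus L} (all_minus L) / real (T_beta L J h \<beta>))
        \<longlongrightarrow> 1) at_top"
      by (rule tendsto_cong[THEN iffD1, rotated]) (use pos in eventually_elim, simp add: E T)
  qed
qed

end
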